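(* Let $V\subseteq[0,1]$ be a truth value set which is either finite or uncountable. Then the prenex fragment of the Gödel logic $\mathbf{G}_V$ is axiomatizable. An axiomatization is given by the standard axioms and rules for $\mathbf{LC}$ extended by the rules (4) from $A(y)$ infer $\forall x\,A(x)$; (5) from $A(t)$ infer $\exists x\,A(x)$; (6) from $\forall x(A(x)\lor B)$ infer $\forall x\,A(x)\lor B$; (7) from $\exists x(A(x)\lor B)$ infer $\exists x\,A(x)\lor B$, where $x$ is not free in $B$; and, in the case that $V$ is finite with exactly $m$ elements, additionally the axiom schema $$\bigvee_{i=1}^m\bigvee_{j=i+1}^{m+1}\bigl((A_i\to A_j)\land(A_j\to A_i)\bigr).$$ That is, a prenex formula belongs to $\mathbf{G}_V$ if and only if it is derivable in this system.
   Context: A truth value set is a set $V\subseteq[0,1]$ that is closed in $\mathbb{R}$ and contains $0$ and $1$. The language $L$ is a standard first-order language with variables, constants, function symbols, predicate symbols (as usual, countably infinitely many of each kind and arity, effectively coded), the predicate constant $\bot$, connectives $\land,\lor,\to$ and quantifiers $\exists,\forall$ (no equality); $\neg A$ abbreviates $A\to\bot$. An interpretation $\mathfrak{I}=\langle D,\mathbf{s}\rangle$ based on $V$ consists of a nonempty domain $D$ and a valuation $\mathbf{s}$ mapping $n$-ary predicate symbols to functions $D^n\to V$, with $\mathbf{s}(\bot)=0$, $n$-ary function symbols to functions $D^n\to D$, and constants and variables to elements of $D$; $L^{\mathfrak I}$ is $L$ extended by a constant for each $d\in D$, with $\mathbf{s}(d)=d$. $\mathbf{s}$ extends to terms as usual.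 Formulas of $L^{\mathfrak I}$ are evaluated by: $\mathfrak{I}(P(t_1,\ldots,t_n))=\mathbf{s}(P)(\mathbf{s}(t_1),\ldots,\mathbf{s}(t_n))$; $\mathfrak{I}(A\land B)=\min(\mathfrak{I}(A),\mathfrak{I}(B))$; $\mathfrak{I}(A\lor B)=\max(\mathfrak{I}(A),\mathfrak{I}(B))$; $\mathfrak{I}(A\to B)=\mathfrak{I}(B)$ if $\mathfrak{I}(A)>\mathfrak{I}(B)$ and $=1$ otherwise; $\mathfrak{I}(\forall x\,A(x))=\inf\{\mathfrak{I}(A(d)):d\in D\}$; $\mathfrak{I}(\exists x\,A(x))=\sup\{\mathfrak{I}(A(d)):d\in D\}$. The Gödel logic $\mathbf{G}_V$ is the set of formulas $A$ of $L$ such that $\mathfrak{I}(A)=1$ for every interpretation $\mathfrak{I}$ based on $V$. A formula is prenex if it has the form $\mathsf{Q}_1x_1\ldots\mathsf{Q}_nx_n\,B$ with $\mathsf{Q}_i\in\{\forall,\exists\}$ and $B$ quantifier-free. The prenex fragment of $\mathbf{G}_V$ is the set of prenex formulas belonging to $\mathbf{G}_V$. A set of formulas is called axiomatizable if it is recursively enumerable. $\mathbf{LC}$ (Dummett's logic) is axiomatized by a standard Hilbert-style system for intuitionistic propositional logic (axiom schemas with modus ponens) plus the schema $(A\to B)\lor(B\to A)$; here the schematic letters range over formulas of $L$. In rule (4), $y$ is a variable not free in $\forall x\,A(x)$ and $A(y)$ is the result of substituting $y$ for $x$ in $A(x)$; in rule (5), $A(t)$ is the result of substituting the term $t$ for $x$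 in $A(x)$ (substitutions avoid variable capture). *)

theory Defs
  imports Complex_Main "HOL-Library.Countable_Set" "HOL-Library.Nat_Bijection"
begin

section \<open>Syntax\<close>

text \<open>
  A function or predicate symbol is a pair of an index and an arity, the arity being the length
  of the argument list. Hence there are countably many symbols of every arity, and every term of
  these datatypes is well-formed. The constants are the function symbols of arity 0.
\<close>

datatype tm = Var nat | Fn nat "tm list"

datatype fm =
    Bot
  | Pr nat "tm list"
  | Conj fm fm
  | Dis fm fm
  | Imp fm fm
  | All nat fm
  | Ex nat fm

primrec vars_tm :: "tm \<Rightarrow> nat set" where
  "vars_tm (Var x) = {x}"
| "vars_tm (Fn f ts) = (\<Union>(set (map vars_tm ts)))"

primrec free_vars :: "fm \<Rightarrow> nat set" where
  "free_vars Bot = {}"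
| "free_vars (Pr p ts) = (\<Union>t\<in>set ts. vars_tm t)"
| "free_vars (Conj A B) = free_vars A \<union> free_vars B"
| "free_vars (Dis A B) = free_vars A \<union> free_vars B"
| "free_vars (Imp A B) = free_vars A \<union> free_vars B"
| "free_vars (All x A) = free_vars A - {x}"
| "free_vars (Ex x A) = free_vars A - {x}"

primrec subst_tm :: "nat \<Rightarrow> tm \<Rightarrow> tm \<Rightarrow> tm" where
  "subst_tm x t (Var y) = (if y = x then t else Var y)"
| "subst_tm x t (Fn f ts) = Fn f (map (subst_tm x t) ts)"

text \<open>
  \<open>subst x t A\<close> replaces the free occurrences of \<open>x\<close> in \<open>A\<close> by \<open>t\<close> without renaming bound
  variables; it is only used under the side condition \<open>free_for t x A\<close>, which excludes capture.
\<close>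

primrec subst :: "nat \<Rightarrow> tm \<Rightarrow> fm \<Rightarrow> fm" where
  "subst x t Bot = Bot"
| "subst x t (Pr p ts) = Pr p (map (subst_tm x t) ts)"
| "subst x t (Conj A B) = Conj (subst x t A) (subst x t B)"
| "subst x t (Dis A B) = Dis (subst x t A) (subst x t B)"
| "subst x t (Imp A B) = Imp (subst x t A) (subst x t B)"
| "subst x t (All y A) = All y (if y = x then A else subst x t A)"
| "subst x t (Ex y A) = Ex y (if y = x then A else subst x t A)"

primrec free_for :: "tm \<Rightarrow> nat \<Rightarrow> fm \<Rightarrow> bool" where
  "free_for t x Bot = True"
| "free_for t x (Pr p ts) = True"
| "free_for t x (Conj A B) = (free_for t x A \<and> free_for t x B)"
| "free_for t x (Dis A B) = (free_for t x A \<and> free_for t x B)"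
| "free_for t x (Imp A B) = (free_for t x A \<and> free_for t x B)"
| "free_for t x (All y A) = (x \<notin> free_vars (All y A) \<or> y \<notin> vars_tm t \<and> free_for t x A)"
| "free_for t x (Ex y A) = (x \<notin> free_vars (Ex y A) \<or> y \<notin> vars_tm t \<and> free_for t x A)"

primrec quantifier_free :: "fm \<Rightarrow> bool" where
  "quantifier_free Bot = True"
| "quantifier_free (Pr p ts) = True"
| "quantifier_free (Conj A B) = (quantifier_free A \<and> quantifier_free B)"
| "quantifier_free (Dis A B) = (quantifier_free A \<and> quantifier_free B)"
| "quantifier_free (Imp A B) = (quantifier_free A \<and> quantifier_free B)"
| "quantifier_free (All x A) = False"
| "quantifier_free (Ex x A) = False"

inductive prenex :: "fm \<Rightarrow> bool" where
  "quantifier_free B \<Longrightarrow> prenex B"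
| "prenex A \<Longrightarrow> prenex (All x A)"
| "prenex A \<Longrightarrow> prenex (Ex x A)"


section \<open>Semantics\<close>

definition truth_value_set :: "real set \<Rightarrow> bool" where
  "truth_value_set V \<longleftrightarrow> V \<subseteq> {0..1} \<and> closed V \<and> 0 \<in> V \<and> 1 \<in> V"

record 'd interp =
  Dom :: "'d set"
  VarI :: "nat \<Rightarrow> 'd"
  FnI :: "nat \<Rightarrow> 'd list \<Rightarrow> 'd"
  PrI :: "nat \<Rightarrow> 'd list \<Rightarrow> real"

text \<open>The values of \<open>FnI\<close> and \<open>PrI\<close> outside \<open>lists (Dom I)\<close> are irrelevant.\<close>

definition interp_on :: "real set \<Rightarrow> 'd interp \<Rightarrow> bool" where
  "interp_on V I \<longleftrightarrow>
     Dom I \<noteq> {} \<and>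
     (\<forall>x. VarI I x \<in> Dom I) \<and>
     (\<forall>f. \<forall>ds\<in>lists (Dom I). FnI I f ds \<in> Dom I) \<and>
     (\<forall>p. \<forall>ds\<in>lists (Dom I). PrI I p ds \<in> V)"

primrec eval_tm :: "'d interp \<Rightarrow> tm \<Rightarrow> 'd" where
  "eval_tm I (Var x) = VarI I x"
| "eval_tm I (Fn f ts) = FnI I f (map (eval_tm I) ts)"

text \<open>
  The value of \<open>A(d)\<close>, for an element \<open>d\<close> of the domain named by itself, is the value of \<open>A\<close>
  after reassigning the variable \<open>x\<close> to \<open>d\<close>.
\<close>

primrec eval :: "fm \<Rightarrow> 'd interp \<Rightarrow> real" where
  "eval Bot I = 0"
| "eval (Pr p ts) I = PrI I p (map (eval_tm I) ts)"
| "eval (Conj A B) I = min (eval A I) (eval B I)"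
| "eval (Dis A B) I = max (eval A I) (eval B I)"
| "eval (Imp A B) I = (if eval A I > eval B I then eval B I else 1)"
| "eval (All x A) I = (INF d\<in>Dom I. eval A (I\<lparr>VarI := (VarI I)(x := d)\<rparr>))"
| "eval (Ex x A) I = (SUP d\<in>Dom I. eval A (I\<lparr>VarI := (VarI I)(x := d)\<rparr>))"

text \<open>
  HOL cannot quantify over all sets inside one formula: the domains range over all nonempty
  subsets of a type \<open>'d\<close>, which is a parameter of the logic and is left arbitrary (but infinite)
  in statements.
\<close>

definition goedel_logic :: "'d itself \<Rightarrow> real set \<Rightarrow> fm set" where
  "goedel_logic D V = {A. \<forall>I :: 'd interp. interp_on V I \<longrightarrow> eval A I = 1}"

definition prenex_fragment :: "'d itself \<Rightarrow> real set \<Rightarrow> fm set" where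
  "prenex_fragment D V = {A \<in> goedel_logic D V. prenex A}"


section \<open>The proof system\<close>

inductive lc_axiom :: "fm \<Rightarrow> bool" where
  "lc_axiom (Imp A (Imp B A))"
| "lc_axiom (Imp (Imp A (Imp B C)) (Imp (Imp A B) (Imp A C)))"
| "lc_axiom (Imp (Conj A B) A)"
| "lc_axiom (Imp (Conj A B) B)"
| "lc_axiom (Imp A (Imp B (Conj A B)))"
| "lc_axiom (Imp A (Dis A B))"
| "lc_axiom (Imp B (Dis A B))"
| "lc_axiom (Imp (Imp A C) (Imp (Imp B C) (Imp (Dis A B) C)))"
| "lc_axiom (Imp Bot A)"
| "lc_axiom (Dis (Imp A B) (Imp B A))"

fun big_disj :: "fm list \<Rightarrow> fm" where
  "big_disj [] = Bot"
| "big_disj [A] = A"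
| "big_disj (A # B # As) = Dis A (big_disj (B # As))"

text \<open>The disjunction over \<open>1 \<le> i \<le> m\<close> and \<open>i + 1 \<le> j \<le> m + 1\<close>; list intervals are half-open.\<close>

definition finite_axiom :: "nat \<Rightarrow> (nat \<Rightarrow> fm) \<Rightarrow> fm" where
  "finite_axiom m A =
     big_disj (map (\<lambda>i. big_disj (map (\<lambda>j. Conj (Imp (A i) (A j)) (Imp (A j) (A i)))
                                   [i + 1..<m + 2]))
                   [1..<m + 1])"

text \<open>Derivability in the extension of the prenex calculus by a set \<open>X\<close> of further axioms.\<close>

inductive derivable :: "fm set \<Rightarrow> fm \<Rightarrow> bool" for X :: "fm set" where
  lc: "lc_axiom A \<Longrightarrow> derivable X A"
| extra: "A \<in> X \<Longrightarrow> derivable X A"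
| mp: "derivable X (Imp A B) \<Longrightarrow> derivable X A \<Longrightarrow> derivable X B"
| all_intro: "derivable X (subst x (Var y) A) \<Longrightarrow> free_for (Var y) x A \<Longrightarrow>
    y \<notin> free_vars (All x A) \<Longrightarrow> derivable X (All x A)"
| ex_intro: "derivable X (subst x t A) \<Longrightarrow> free_for t x A \<Longrightarrow> derivable X (Ex x A)"
| all_shift: "derivable X (All x (Dis A B)) \<Longrightarrow> x \<notin> free_vars B \<Longrightarrow>
    derivable X (Dis (All x A) B)"
| ex_shift: "derivable X (Ex x (Dis A B)) \<Longrightarrow> x \<notin> free_vars B \<Longrightarrow>
    derivable X (Dis (Ex x A) B)"

definition extra_axioms :: "real set \<Rightarrow> fm set" where
  "extra_axioms V = (if finite V then range (finite_axiom (card V)) else {})"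


section \<open>Recursive enumerability\<close>

datatype recf = Zero | Succ | Proj nat | Comp recf "recf list" | PrimRec recf recf | Mu recf

text \<open>
  \<open>computes f xs y\<close>: the partial recursive function described by \<open>f\<close> is defined at the argument
  tuple \<open>xs\<close> and has value \<open>y\<close> there. In primitive recursion and minimization the distinguished
  argument comes first.
\<close>

inductive computes :: "recf \<Rightarrow> nat list \<Rightarrow> nat \<Rightarrow> bool" where
  "computes Zero xs 0"
| "computes Succ [n] (Suc n)"
| "i < length xs \<Longrightarrow> computes (Proj i) xs (xs ! i)"
| "list_all2 (\<lambda>g y. computes g xs y) gs ys \<Longrightarrow> computes f ys z \<Longrightarrow> computes (Comp f gs) xs z"
| "computes f xs y \<Longrightarrow> computes (PrimRec f g) (0 # xs) y"
| "computes (PrimRec f g) (n # xs) y \<Longrightarrow> computes g (n # y # xs) z \<Longrightarrow>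
    computes (PrimRec f g) (Suc n # xs) z"
| "computes f (n # xs) 0 \<Longrightarrow> (\<forall>i<n. \<exists>k. computes f (i # xs) (Suc k)) \<Longrightarrow>
    computes (Mu f) xs n"

text \<open>A set of numbers is r.e. iff it is the domain of a unary partial recursive function.\<close>

definition recursively_enumerable :: "nat set \<Rightarrow> bool" where
  "recursively_enumerable S \<longleftrightarrow> (\<exists>f. \<forall>n. n \<in> S \<longleftrightarrow> (\<exists>y. computes f [n] y))"

text \<open>An explicit effective Goedel numbering (\<open>to_nat\<close> would only be some injection).\<close>

primrec code_tm :: "tm \<Rightarrow> nat" where
  "code_tm (Var x) = prod_encode (0, x)"
| "code_tm (Fn f ts) = prod_encode (1, prod_encode (f, list_encode (map code_tm ts)))"

primrec code_fm :: "fm \<Rightarrow> nat" where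
  "code_fm Bot = prod_encode (0, 0)"
| "code_fm (Pr p ts) = prod_encode (1, prod_encode (p, list_encode (map code_tm ts)))"
| "code_fm (Conj A B) = prod_encode (2, prod_encode (code_fm A, code_fm B))"
| "code_fm (Dis A B) = prod_encode (3, prod_encode (code_fm A, code_fm B))"
| "code_fm (Imp A B) = prod_encode (4, prod_encode (code_fm A, code_fm B))"
| "code_fm (All x A) = prod_encode (5, prod_encode (x, code_fm A))"
| "code_fm (Ex x A) = prod_encode (6, prod_encode (x, code_fm A))"

lemma code_tm_inject: "code_tm s = code_tm t \<Longrightarrow> s = t"
proof (induction s arbitrary: t)
  case (Var x)
  then show ?case by (cases t) auto
next
  case (Fn f ss)
  then obtain ts where t: "t = Fn f ts" and "map code_tm ss = map code_tm ts"
    by (cases t) (auto simp: list_encode_eq)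
  then have "ss = ts"
    using Fn.IH by (auto simp: list_eq_iff_nth_eq map_eq_conv intro!: nth_equalityI)
  with t show ?case by simp
qed

lemma code_fm_inject: "code_fm A = code_fm B \<Longrightarrow> A = B"
proof (induction A arbitrary: B)
  case (Pr p ss)
  have "inj code_tm" by (rule injI) (rule code_tm_inject)
  with Pr show ?case by (cases B) (auto simp: list_encode_eq inj_map_eq_map)
qed (case_tac B; force)+

definition axiomatizable :: "fm set \<Rightarrow> bool" where
  "axiomatizable F \<longleftrightarrow> recursively_enumerable (code_fm ` F)"

end

theory Submission
  imports Defs "HOL-Analysis.Elementary_Metric_Spaces"
begin

text \<open>
  Axiomatizability: the syntactic relations of the calculus (substitution, freshness, being prenex,
  derivability) are the least relations closed under finitely many Horn clauses over codes, and the
  set of consequences of a finite set of Horn clauses is recursively enumerable.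

  Completeness: let \<open>A\<close> be prenex and not derivable. The rules (4)-(7) absorb a disjunct
  \<open>C(t)\<close> into \<open>\<exists>x C\<close>, and \<open>C(y)\<close> with a fresh \<open>y\<close> into \<open>\<forall>x C\<close>. Hence
  \<open>A\<close> extends to a set \<open>D\<close>, no finite disjunction of which is derivable, that contains all
  instances of its existential formulas and one instance of each of its universal formulas. A prime
  theory \<open>T\<close> disjoint from \<open>D\<close> is linearly ordered by \<open>B \<rightarrow> B' \<in> T\<close>, because of the
  linearity axiom. This countable chain embeds into \<open>V\<close> with the complement of \<open>T\<close> bounded
  by some \<open>c < 1\<close>: in the finite case it has at most as many elements as \<open>V\<close>, and an
  uncountable \<open>V\<close> contains a dense chain below some \<open>c < 1\<close>. Suprema and infima need not be
  preserved: in the resulting term model every formula of \<open>D\<close> has value at most \<open>c\<close>, since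
  \<open>\<exists>x C\<close> is the supremum of instances in \<open>D\<close> and \<open>\<forall>x C\<close> lies below one of them.
\<close>

section \<open>Total recursive functions\<close>

inductive_cases computes_ZeroE: "computes Zero xs y"
inductive_cases computes_SuccE: "computes Succ xs y"
inductive_cases computes_ProjE: "computes (Proj i) xs y"
inductive_cases computes_CompE: "computes (Comp f gs) xs y"
inductive_cases computes_PrimRec_0E: "computes (PrimRec f g) (0 # xs) y"
inductive_cases computes_PrimRec_SucE: "computes (PrimRec f g) (Suc n # xs) y"
inductive_cases computes_MuE: "computes (Mu f) xs y"

text \<open>Lets the value of a halting computation be compared with a known one. For minimization,
  the smaller of two distinct results would be a zero of \<open>f\<close> and also, lying below the
  other result, a place with a successor value.\<close>

lemma computes_deterministic:
  "computes f xs y \<Longrightarrow> computes f xs z \<Longrightarrow> y = z"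
proof (induction f xs y arbitrary: z rule: computes.induct)
  case (4 xs gs ys f z z')
  from 4(4) obtain ys' where ys': "list_all2 (\<lambda>g y. computes g xs y) gs ys'" "computes f ys' z'"
    by (rule computes_CompE)
  have "ys = ys'"
  proof (rule nth_equalityI)
    show "length ys = length ys'" using list_all2_lengthD[OF 4(1)] list_all2_lengthD[OF ys'(1)] by simp
    fix i assume "i < length ys"
    then show "ys ! i = ys' ! i"
      using 4(1) ys'(1) by (auto simp: list_all2_conv_all_nth)
  qed
  with ys'(2) show ?case using 4 by blast
next
  case (5 f xs y g)
  from 5(3) have "computes f xs z" by (rule computes_PrimRec_0E)
  then show ?case by (rule 5(2))
next
  case (6 f g n xs y z z')
  from 6(5) obtain y' where "computes (PrimRec f g) (n # xs) y'" "computes g (n # y' # xs) z'"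
    by (rule computes_PrimRec_SucE)
  then show ?case using "6.IH" by metis
next
  case (7 f n xs)
  from 7(4) have z: "computes f (z # xs) 0" "\<forall>i<z. \<exists>k. computes f (i # xs) (Suc k)"
    by (auto elim: computes_MuE)
  show ?case
  proof (cases n z rule: linorder_cases)
    case less
    then show ?thesis using z(2) 7 by (metis nat.distinct(1))
  next
    case greater
    then show ?thesis using z(1) 7 by (metis nat.distinct(1))
  qed
qed (auto elim: computes_ZeroE computes_SuccE computes_ProjE)

text \<open>Functions are given extensionally on argument lists of length \<open>k\<close>, so
  closure properties can be combined without writing programs in \<open>recf\<close>.\<close>

definition total_rec :: "nat \<Rightarrow> (nat list \<Rightarrow> nat) \<Rightarrow> bool" where
  "total_rec k F \<longleftrightarrow> (\<exists>f. \<forall>xs. length xs = k \<longrightarrow> computes f xs (F xs))"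

lemma total_rec_cong:
  "total_rec k F \<Longrightarrow> (\<And>xs. length xs = k \<Longrightarrow> F xs = G xs) \<Longrightarrow> total_rec k G"
  unfolding total_rec_def by metis

lemma total_rec_zero: "total_rec k (\<lambda>xs. 0)"
  unfolding total_rec_def using computes.intros(1) by blast

lemma total_rec_nth [intro]: "i < k \<Longrightarrow> total_rec k (\<lambda>xs. xs ! i)"
  unfolding total_rec_def using computes.intros(3) by blast

lemma total_rec_comp_list:
  assumes "total_rec m F" and "length Gs = m" and "\<forall>G\<in>set Gs. total_rec k G"
  shows "total_rec k (\<lambda>xs. F (map (\<lambda>G. G xs) Gs))"
proof -
  obtain f where f: "\<And>xs. length xs = m \<Longrightarrow> computes f xs (F xs)"
    using assms(1) unfolding total_rec_def by blast
  obtain g where g: "\<And>G xs. G \<in> set Gs \<Longrightarrow> length xs = k \<Longrightarrow> computes (g G) xs (G xs)"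
    using assms(3) unfolding total_rec_def by metis
  have "computes (Comp f (map g Gs)) xs (F (map (\<lambda>G. G xs) Gs))" if "length xs = k" for xs
    using that f[of "map (\<lambda>G. G xs) Gs"] g assms(2)
    by (intro computes.intros(4)[where ys = "map (\<lambda>G. G xs) Gs"])
      (auto simp: list_all2_conv_all_nth)
  then show ?thesis unfolding total_rec_def by blast
qed

lemma total_rec_comp1:
  "total_rec 1 (\<lambda>xs. h (xs ! 0)) \<Longrightarrow> total_rec k A \<Longrightarrow> total_rec k (\<lambda>xs. h (A xs))"
  using total_rec_comp_list[of 1 "\<lambda>xs. h (xs ! 0)" "[A]" k] by simp

lemma total_rec_comp2:
  "total_rec 2 (\<lambda>xs. h (xs ! 0) (xs ! 1)) \<Longrightarrow> total_rec k A \<Longrightarrow> total_rec k B \<Longrightarrow>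
    total_rec k (\<lambda>xs. h (A xs) (B xs))"
  using total_rec_comp_list[of 2 "\<lambda>xs. h (xs ! 0) (xs ! 1)" "[A, B]" k] by simp

lemma total_rec_Suc [intro]: "total_rec k A \<Longrightarrow> total_rec k (\<lambda>xs. Suc (A xs))"
proof -
  assume "total_rec k A"
  have "computes Succ xs (Suc (xs ! 0))" if "length xs = 1" for xs
    using that computes.intros(2) by (cases xs) auto
  then have "total_rec 1 (\<lambda>xs. Suc (xs ! 0))" unfolding total_rec_def by blast
  then show ?thesis using \<open>total_rec k A\<close> by (rule total_rec_comp1)
qed

lemma total_rec_const [intro]: "total_rec k (\<lambda>xs. c)"
  by (induction c) (auto intro: total_rec_zero total_rec_Suc)

text \<open>\<open>PrimRec\<close> recurses on its first argument; composing with \<open>N\<close>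
  and the projections runs the recursion up to a computed bound while the step function still sees
  all of \<open>xs\<close>.\<close>

lemma total_rec_rec:
  assumes "total_rec k N" and "total_rec k F" and "total_rec (Suc (Suc k)) G"
  shows "total_rec k (\<lambda>xs. rec_nat (F xs) (\<lambda>n y. G (n # y # xs)) (N xs))"
proof -
  obtain f g where f: "\<And>xs. length xs = k \<Longrightarrow> computes f xs (F xs)"
    and g: "\<And>xs. length xs = Suc (Suc k) \<Longrightarrow> computes g xs (G xs)"
    using assms(2,3) unfolding total_rec_def by blast
  let ?h = "\<lambda>xs n. rec_nat (F xs) (\<lambda>n y. G (n # y # xs)) n"
  have 1: "computes (PrimRec f g) (n # xs) (?h xs n)" if "length xs = k" for xs n
    using that
  proof (induction n)
    case (Suc n)
    then show ?case using g[of "n # ?h xs n # xs"] by (auto intro: computes.intros)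
  qed (auto intro: computes.intros f)
  have "computes (PrimRec f g) xs (?h (tl xs) (xs ! 0))" if "length xs = Suc k" for xs
    using that 1[of "tl xs" "xs ! 0"] by (cases xs) auto
  then have 2: "total_rec (Suc k) (\<lambda>xs. ?h (tl xs) (xs ! 0))"
    unfolding total_rec_def by blast
  have "total_rec k (\<lambda>xs. ?h (tl (map (\<lambda>G. G xs) (N # map (\<lambda>i xs. xs ! i) [0..<k])))
     (map (\<lambda>G. G xs) (N # map (\<lambda>i xs. xs ! i) [0..<k]) ! 0))"
    by (rule total_rec_comp_list[OF 2]) (auto simp: assms(1))
  then show ?thesis
  proof (rule total_rec_cong)
    fix xs :: "nat list" assume "length xs = k"
    then have "map (\<lambda>i. xs ! i) [0..<k] = xs" by (metis map_nth)
    then show "?h (tl (map (\<lambda>G. G xs) (N # map (\<lambda>i xs. xs ! i) [0..<k])))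
     (map (\<lambda>G. G xs) (N # map (\<lambda>i xs. xs ! i) [0..<k]) ! 0) = ?h xs (N xs)"
      by (simp add: comp_def)
  qed
qed

text \<open>The step function of a recursion receives the counter and the previous value in front of
  \<open>xs\<close>; this discards them.\<close>

lemma total_rec_weaken2:
  assumes "total_rec k A" shows "total_rec (Suc (Suc k)) (\<lambda>xs. A (tl (tl xs)))"
proof -
  have "total_rec (Suc (Suc k)) (\<lambda>xs. A (map (\<lambda>G. G xs) (map (\<lambda>i xs. xs ! (i + 2)) [0..<k])))"
    by (rule total_rec_comp_list[OF assms]) auto
  then show ?thesis
  proof (rule total_rec_cong)
    fix xs :: "nat list" assume "length xs = Suc (Suc k)"
    then have "map (\<lambda>i. xs ! (i + 2)) [0..<k] = tl (tl xs)"
      by (auto intro!: nth_equalityI simp: nth_tl)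
    then show "A (map (\<lambda>G. G xs) (map (\<lambda>i xs. xs ! (i + 2)) [0..<k])) = A (tl (tl xs))"
      by (simp add: comp_def)
  qed
qed

lemma total_rec_iterate:
  assumes "total_rec k N" and "total_rec k F" and "total_rec 2 (\<lambda>xs. g (xs ! 0) (xs ! 1))"
  shows "total_rec k (\<lambda>xs. rec_nat (F xs) g (N xs))"
  using total_rec_rec[OF assms(1,2) total_rec_comp2[OF assms(3), of "Suc (Suc k)" "\<lambda>xs. xs ! 0" "\<lambda>xs. xs ! 1"]]
  by auto

section \<open>Arithmetic, decidable predicates and bounded sums\<close>

lemma total_rec_add:
  assumes "total_rec k A" "total_rec k B" shows "total_rec k (\<lambda>xs. A xs + B xs)"
proof -
  have eq: "rec_nat a (\<lambda>n y. Suc y) b = a + b" for a b :: nat by (induction b) auto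
  then show ?thesis
    using total_rec_iterate[OF assms(2,1), of "\<lambda>n y. Suc y"]
    by (simp add: eq total_rec_Suc total_rec_nth)
qed

lemma total_rec_mult:
  assumes "total_rec k A" "total_rec k B" shows "total_rec k (\<lambda>xs. A xs * B xs)"
proof -
  have eq: "rec_nat 0 (\<lambda>n y. y + a) b = a * b" for a b :: nat by (induction b) auto
  have "total_rec k (\<lambda>xs. rec_nat ((\<lambda>_. 0) xs) (\<lambda>n y. (\<lambda>xs. xs ! 1 + A (tl (tl xs))) (n # y # xs)) (B xs))"
    using assms total_rec_weaken2[OF assms(1)] by (intro total_rec_rec total_rec_add) auto
  then show ?thesis by (simp add: eq)
qed

lemma total_rec_sub:
  assumes "total_rec k A" "total_rec k B" shows "total_rec k (\<lambda>xs. A xs - B xs)"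
proof -
  \<comment> \<open>Predecessor is the recursion whose step returns its counter; iterating it gives
    truncated subtraction.\<close>
  have p: "rec_nat 0 (\<lambda>n y. n) a = a - Suc 0" for a :: nat by (cases a) auto
  have pred: "total_rec k (\<lambda>xs. C xs - 1)" if "total_rec k C" for C k
    using total_rec_iterate[OF that total_rec_const, of "\<lambda>n y. n" 0] total_rec_nth[of 0 2] by (simp add: p)
  have eq: "rec_nat a (\<lambda>n y. y - 1) b = a - b" for a b :: nat by (induction b) auto
  show ?thesis
    using total_rec_iterate[OF assms(2,1), of "\<lambda>n y. y - 1"] pred[of 2 "\<lambda>xs. xs ! 1", OF total_rec_nth]
    by (simp only: eq)
qed

definition total_rec_pred :: "nat \<Rightarrow> (nat list \<Rightarrow> bool) \<Rightarrow> bool" where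
  "total_rec_pred k P \<longleftrightarrow> total_rec k (\<lambda>xs. of_bool (P xs))"

lemma total_rec_pred_conj:
  assumes "total_rec_pred k P" "total_rec_pred k Q"
  shows "total_rec_pred k (\<lambda>xs. P xs \<and> Q xs)"
  using total_rec_mult[OF assms[unfolded total_rec_pred_def]]
  by (simp add: total_rec_pred_def of_bool_conj)

lemma total_rec_pred_le:
  assumes "total_rec k A" "total_rec k B" shows "total_rec_pred k (\<lambda>xs. A xs \<le> B xs)"
proof -
  have "total_rec k (\<lambda>xs. 1 - (A xs - B xs))" using assms by (intro total_rec_sub total_rec_const)
  moreover have "1 - (a - b) = of_bool (a \<le> b)" for a b :: nat by auto
  ultimately show ?thesis by (simp add: total_rec_pred_def)
qed

lemma total_rec_pred_eq:
  assumes "total_rec k A" "total_rec k B" shows "total_rec_pred k (\<lambda>xs. A xs = B xs)"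
  unfolding eq_iff using assms by (intro total_rec_pred_conj total_rec_pred_le)

lemma total_rec_if:
  assumes "total_rec_pred k P" "total_rec k A" "total_rec k B"
  shows "total_rec k (\<lambda>xs. if P xs then A xs else B xs)"
proof -
  have "total_rec k (\<lambda>xs. of_bool (P xs) * A xs + (1 - of_bool (P xs)) * B xs)"
    using assms unfolding total_rec_pred_def
    by (intro total_rec_add total_rec_mult total_rec_sub total_rec_const)
  then show ?thesis by (rule total_rec_cong) auto
qed

lemma total_rec_sum:
  assumes "total_rec k N" and "total_rec (Suc (Suc k)) G"
    and "\<And>n y xs. G (n # y # xs) = y + g n xs"
  shows "total_rec k (\<lambda>xs. \<Sum>i<N xs. g i xs)"
proof -
  have "rec_nat 0 (\<lambda>n y. G (n # y # xs)) b = (\<Sum>i<b. g i xs)" for b xs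
    by (induction b) (auto simp: assms(3))
  then show ?thesis
    using total_rec_rec[OF assms(1) total_rec_const assms(2), of 0] by simp
qed

text \<open>The recursion behind the sum carries the running total at position 1; the summand
  expects only the index in front of \<open>xs\<close>, so that position is cut out.\<close>

lemma total_rec_sum_nth:
  assumes "total_rec k N" and "total_rec (Suc k) (\<lambda>xs. g (xs ! 0) (tl xs))"
  shows "total_rec k (\<lambda>xs. \<Sum>i<N xs. g i xs)"
proof (rule total_rec_sum[OF assms(1)])
  have "total_rec (Suc (Suc k)) (\<lambda>xs. (\<lambda>xs. g (xs ! 0) (tl xs))
     (map (\<lambda>G. G xs) ((\<lambda>xs. xs ! 0) # map (\<lambda>i xs. xs ! (i + 2)) [0..<k])))"
    by (rule total_rec_comp_list[OF assms(2)]) auto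
  then have "total_rec (Suc (Suc k)) (\<lambda>xs. g (xs ! 0) (tl (tl xs)))"
  proof (rule total_rec_cong)
    fix xs :: "nat list" assume "length xs = Suc (Suc k)"
    then have "map (\<lambda>i. xs ! (i + 2)) [0..<k] = tl (tl xs)"
      by (auto intro!: nth_equalityI simp: nth_tl)
    then show "(\<lambda>xs. g (xs ! 0) (tl xs))
       (map (\<lambda>G. G xs) ((\<lambda>xs. xs ! 0) # map (\<lambda>i xs. xs ! (i + 2)) [0..<k]))
      = g (xs ! 0) (tl (tl xs))"
      by (simp add: comp_def)
  qed
  then show "total_rec (Suc (Suc k)) (\<lambda>xs. xs ! 1 + g (xs ! 0) (tl (tl xs)))"
    by (intro total_rec_add) auto
qed simp

text \<open>The quotient counts the \<open>i < a\<close> with \<open>Suc i * b \<le> a\<close>. The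
  conjunct \<open>1 \<le> b\<close> makes the count 0 for \<open>b = 0\<close>, in agreement with
  \<open>a div 0 = 0\<close>.\<close>

lemma total_rec_div:
  assumes "total_rec k A" "total_rec k B"
  shows "total_rec k (\<lambda>xs. A xs div B xs)"
proof (rule total_rec_comp2[OF _ assms])
  have eq: "(\<Sum>i<a. of_bool (1 \<le> b \<and> Suc i * b \<le> a)) = a div b" for a b :: nat
  proof (cases "b = 0")
    case False
    have "{i. i < a \<and> Suc i * b \<le> a} = {..<a div b}"
    proof -
      have "Suc i * b \<le> a \<longleftrightarrow> i < a div b" for i
        using False by (metis Suc_le_eq less_eq_div_iff_mult_less_eq neq0_conv)
      moreover have "i < a div b \<Longrightarrow> i < a" for i
        using div_le_dividend[of a b] by linarith
      ultimately show ?thesis by blast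
    qed
    moreover have "(\<Sum>i<a. of_bool (1 \<le> b \<and> Suc i * b \<le> a)) = card {i. i < a \<and> Suc i * b \<le> a}"
    proof -
      have "{..<a} \<inter> {i. 1 \<le> b \<and> Suc i * b \<le> a} = {i. i < a \<and> Suc i * b \<le> a}"
        using False by (auto simp del: mult_Suc)
      then show ?thesis by (simp add: sum_of_bool_eq del: mult_Suc)
    qed
    ultimately show ?thesis by simp
  qed simp
  have "total_rec 2 (\<lambda>xs. \<Sum>i<xs ! 0. of_bool (1 \<le> xs ! 1 \<and> Suc i * (xs ! 1) \<le> xs ! 0))"
  proof (rule total_rec_sum_nth)
    have "total_rec (Suc 2) (\<lambda>xs. of_bool (1 \<le> xs ! 2 \<and> Suc (xs ! 0) * (xs ! 2) \<le> xs ! 1))"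
      unfolding total_rec_pred_def[symmetric] by (intro total_rec_pred_conj total_rec_pred_le
          total_rec_mult total_rec_Suc total_rec_nth total_rec_const) auto
    then show "total_rec (Suc 2) (\<lambda>xs. of_bool (1 \<le> tl xs ! 1 \<and> Suc (xs ! 0) * (tl xs ! 1) \<le> tl xs ! 0))"
      by (rule total_rec_cong) (auto simp: nth_tl numeral_2_eq_2)
  qed auto
  then show "total_rec 2 (\<lambda>xs. xs ! 0 div xs ! 1)" by (simp only: eq)
qed

lemma total_rec_power2:
  assumes "total_rec k A" shows "total_rec k (\<lambda>xs. 2 ^ A xs)"
proof -
  have eq: "rec_nat 1 (\<lambda>n y. y + y) b = (2 :: nat) ^ b" for b by (induction b) auto
  have "total_rec 2 (\<lambda>xs. xs ! 1 + xs ! 1)" by (intro total_rec_add total_rec_nth) auto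
  then show ?thesis
    using total_rec_iterate[OF assms total_rec_const, of "\<lambda>n y. y + y" 1] by (simp only: eq)
qed

lemma total_rec_pred_odd:
  assumes "total_rec k A" shows "total_rec_pred k (\<lambda>xs. odd (A xs))"
proof -
  have "total_rec k (\<lambda>xs. A xs - 2 * (A xs div 2))"
    using assms by (intro total_rec_sub total_rec_mult total_rec_div total_rec_const)
  moreover have "a - 2 * (a div 2) = of_bool (odd a)" for a :: nat
    by (metis minus_mult_div_eq_mod mod2_eq_if of_bool_def)
  ultimately show ?thesis by (simp add: total_rec_pred_def)
qed

section \<open>Pairing, unpairing and projection\<close>

lemma total_rec_prod_encode:
  assumes "total_rec k A" "total_rec k B"
  shows "total_rec k (\<lambda>xs. prod_encode (A xs, B xs))"
  unfolding prod_encode_def triangle_def prod.case using assms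
  by (intro total_rec_add total_rec_div total_rec_mult total_rec_Suc total_rec_const)

text \<open>Bounded search, written as a sum over all pairs below \<open>n\<close>.\<close>

lemma prod_decode_sum:
  "(\<Sum>i<Suc n. \<Sum>j<Suc n. f i j * of_bool (prod_encode (i, j) = n)) =
    f (fst (prod_decode n)) (snd (prod_decode n))" for f :: "nat \<Rightarrow> nat \<Rightarrow> nat"
proof -
  obtain a b where ab: "prod_decode n = (a, b)" by force
  then have n: "n = prod_encode (a, b)" by (metis prod_decode_inverse)
  have "(\<Sum>j<Suc n. f i j * of_bool (prod_encode (i, j) = n)) = (if i = a then f a b else 0)" for i
  proof -
    have "(\<Sum>j<Suc n. f i j * of_bool (prod_encode (i, j) = n)) =
      (\<Sum>j<Suc n. if j = b then (if i = a then f a b else 0) else 0)"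
      unfolding n by (intro sum.cong) auto
    also have "\<dots> = (if i = a then f a b else 0)"
      using le_prod_encode_2[of b a] by (simp add: n le_imp_less_Suc del: sum.lessThan_Suc)
    finally show ?thesis .
  qed
  then show ?thesis using le_prod_encode_1[of a b]
    by (simp add: ab le_imp_less_Suc n[symmetric] del: sum.lessThan_Suc)
qed

text \<open>Keeping \<open>f\<close> arbitrary in the search sum makes both projections instances of
  one lemma.\<close>

lemma total_rec_prod_decode:
  assumes f: "total_rec 2 (\<lambda>xs. f (xs ! 0) (xs ! 1))" and A: "total_rec k A"
  shows "total_rec k (\<lambda>xs. f (fst (prod_decode (A xs))) (snd (prod_decode (A xs))))"
proof (rule total_rec_comp1[OF _ A])
  \<comment> \<open>The arguments are \<open>j\<close>, \<open>i\<close>, \<open>n\<close> in this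
    order, since each sum puts its index in front.\<close>
  have "total_rec 3 (\<lambda>xs. f (xs ! 1) (xs ! 0) * of_bool (prod_encode (xs ! 1, xs ! 0) = xs ! 2))"
  
    by (intro total_rec_mult total_rec_comp2[OF f] total_rec_pred_eq[unfolded total_rec_pred_def]
        total_rec_prod_encode total_rec_nth) auto
  then have 1: "total_rec (Suc 2) (\<lambda>xs. f (tl xs ! 0) (xs ! 0) *
      of_bool (prod_encode (tl xs ! 0, xs ! 0) = tl xs ! 1))"
    by (rule_tac total_rec_cong) (auto simp: nth_tl eval_nat_numeral)
  have "total_rec 2 (\<lambda>xs. \<Sum>j<Suc (xs ! 1). f (xs ! 0) j * of_bool (prod_encode (xs ! 0, j) = xs ! 1))"
    by (rule total_rec_sum_nth[OF _ 1]) (auto intro!: total_rec_Suc)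
  then have 2: "total_rec (Suc 1) (\<lambda>xs. \<Sum>j<Suc (tl xs ! 0). f (xs ! 0) j *
      of_bool (prod_encode (xs ! 0, j) = tl xs ! 0))"
    by (rule_tac total_rec_cong) (auto simp: nth_tl eval_nat_numeral)
  have "total_rec 1 (\<lambda>xs. \<Sum>i<Suc (xs ! 0). \<Sum>j<Suc (xs ! 0). f i j * of_bool (prod_encode (i, j) = xs ! 0))"
    by (rule total_rec_sum_nth[OF _ 2]) (auto intro!: total_rec_Suc)
  then show "total_rec 1 (\<lambda>xs. f (fst (prod_decode (xs ! 0))) (snd (prod_decode (xs ! 0))))"
    by (simp only: prod_decode_sum)
qed

lemma total_rec_fst_decode:
  "total_rec k A \<Longrightarrow> total_rec k (\<lambda>xs. fst (prod_decode (A xs)))"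
  by (rule total_rec_prod_decode[where f = "\<lambda>a b. a"]) (auto intro: total_rec_nth)

lemma total_rec_snd_decode:
  "total_rec k A \<Longrightarrow> total_rec k (\<lambda>xs. snd (prod_decode (A xs)))"
  by (rule total_rec_prod_decode[where f = "\<lambda>a b. b"]) (auto intro: total_rec_nth)

text \<open>\<open>Mu\<close> searches for a zero, so it is applied to the characteristic function
  of the complement of \<open>P\<close> and halts exactly when a witness \<open>k\<close>
  exists.\<close>

lemma recursively_enumerable_projection:
  assumes "total_rec_pred 2 (\<lambda>xs. P (xs ! 0) (xs ! 1))"
  shows "recursively_enumerable {n. \<exists>k. P k n}"
proof -
  have "total_rec 2 (\<lambda>xs. 1 - of_bool (P (xs ! 0) (xs ! 1)))"
    using assms unfolding total_rec_pred_def by (intro total_rec_sub total_rec_const)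
  then obtain g where "\<And>xs. length xs = 2 \<Longrightarrow> computes g xs (1 - of_bool (P (xs ! 0) (xs ! 1)))"
    unfolding total_rec_def by blast
  then have g: "computes g [k, n] (1 - of_bool (P k n))" for k n
    by (metis One_nat_def Suc_1 length_Cons list.size(3) nth_Cons_0 nth_Cons_Suc)
  have "(\<exists>k. P k n) \<longleftrightarrow> (\<exists>y. computes (Mu g) [n] y)" for n
  proof
    assume "\<exists>k. P k n"
    then have l: "P (LEAST k. P k n) n" by (auto intro: LeastI)
    have "computes (Mu g) [n] (LEAST k. P k n)"
    proof (rule computes.intros(7))
      show "computes g [LEAST k. P k n, n] 0" using g[of "LEAST k. P k n" n] l by simp
      show "\<forall>i<(LEAST k. P k n). \<exists>k. computes g [i, n] (Suc k)"
      proof (intro allI impI)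
        fix i assume "i < (LEAST k. P k n)"
        then have "\<not> P i n" by (rule not_less_Least)
        then show "\<exists>k. computes g [i, n] (Suc k)" using g[of i n] by auto
      qed
    qed
    then show "\<exists>y. computes (Mu g) [n] y" by blast
  next
    assume "\<exists>y. computes (Mu g) [n] y"
    then obtain y where "computes (Mu g) [n] y" by blast
    then have "computes g [y, n] 0" by (cases rule: computes.cases) auto
    then have "1 - of_bool (P y n) = (0 :: nat)" using g[of y n] computes_deterministic by blast
    then have "P y n" by (cases "P y n") auto
    then show "\<exists>k. P k n" by blast
  qed
  then show ?thesis unfolding recursively_enumerable_def by blast
qed

section \<open>Consequences of Horn clauses\<close>

text \<open>Expressions for numbers built from the operations that occur in the codes;
  \<open>PS\<close> yields the nonempty values of \<open>list_encode\<close>, and also plain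
  successors.\<close>

datatype pat = PV nat | PC nat | PS pat | PP pat pat

primrec pat_val :: "(nat \<Rightarrow> nat) \<Rightarrow> pat \<Rightarrow> nat" where
  "pat_val e (PV i) = e i"
| "pat_val e (PC c) = c"
| "pat_val e (PS p) = Suc (pat_val e p)"
| "pat_val e (PP p q) = prod_encode (pat_val e p, pat_val e q)"

inductive horn :: "(pat list \<times> pat) list \<Rightarrow> nat \<Rightarrow> bool" for cls where
  step: "(ps, c) \<in> set cls \<Longrightarrow> \<forall>p\<in>set ps. horn cls (pat_val e p) \<Longrightarrow> horn cls (pat_val e c)"

text \<open>A single number serves as an environment by iterated unpairing; any finite part of an
  environment is realized by some code.\<close>

primrec decode_env :: "nat \<Rightarrow> nat \<Rightarrow> nat" where
  "decode_env c 0 = fst (prod_decode c)"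
| "decode_env c (Suc i) = decode_env (snd (prod_decode c)) i"

lemma decode_env_surj: "\<exists>c. \<forall>i<N. decode_env c i = e i"
proof (induction N arbitrary: e)
  case (Suc N)
  obtain c where "\<forall>i<N. decode_env c i = e (Suc i)" using Suc[of "\<lambda>i. e (Suc i)"] by blast
  then have "\<forall>i<Suc N. decode_env (prod_encode (e 0, c)) i = e i"
    by (auto simp: less_Suc_eq_0_disj)
  then show ?case by blast
qed simp

primrec pat_bound :: "pat \<Rightarrow> nat" where
  "pat_bound (PV i) = Suc i"
| "pat_bound (PC c) = 0"
| "pat_bound (PS p) = pat_bound p"
| "pat_bound (PP p q) = max (pat_bound p) (pat_bound q)"

lemma pat_val_cong: "(\<And>i. i < pat_bound p \<Longrightarrow> e i = e' i) \<Longrightarrow> pat_val e p = pat_val e' p"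
  by (induction p) auto

definition fire :: "(nat \<Rightarrow> nat) \<Rightarrow> pat list \<times> pat \<Rightarrow> nat set \<Rightarrow> nat set" where
  "fire e cl S = (if \<forall>p\<in>set (fst cl). pat_val e p \<in> S then insert (pat_val e (snd cl)) S else S)"

text \<open>
  Stage \<open>n\<close> applies every clause once, with the environment coded by the second component of \<open>n\<close>;
  hence every environment recurs at arbitrarily late stages.
\<close>

primrec stage :: "(pat list \<times> pat) list \<Rightarrow> nat \<Rightarrow> nat set" where
  "stage cls 0 = {}"
| "stage cls (Suc n) = fold (fire (decode_env (snd (prod_decode n)))) cls (stage cls n)"

lemma fold_fire_increasing: "S \<subseteq> fold (fire e) cls S"
proof (induction cls arbitrary: S)
  case (Cons cl cls)
  have "S \<subseteq> fire e cl S" unfolding fire_def by auto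
  also have "\<dots> \<subseteq> fold (fire e) cls (fire e cl S)" by (rule Cons)
  finally show ?case by simp
qed simp

text \<open>Clauses processed earlier only enlarge the set, so the premises are still present when
  this one fires; later ones keep its conclusion.\<close>

lemma fold_fire_derives:
  assumes "(ps, c) \<in> set cls" and "\<forall>p\<in>set ps. pat_val e p \<in> S"
  shows "pat_val e c \<in> fold (fire e) cls S"
proof -
  obtain as bs where cls: "cls = as @ (ps, c) # bs" using assms(1) by (auto dest: split_list)
  have "S \<subseteq> fold (fire e) as S" by (rule fold_fire_increasing)
  then have "pat_val e c \<in> fire e (ps, c) (fold (fire e) as S)"
    using assms(2) unfolding fire_def by auto
  then show ?thesis unfolding cls using fold_fire_increasing by fastforce
qed

lemma fold_fire_sound:
  "set cls \<subseteq> set cls' \<Longrightarrow> \<forall>n\<in>S. horn cls' n \<Longrightarrow> \<forall>n\<in>fold (fire e) cls S. horn cls' n"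
proof (induction cls arbitrary: S)
  case (Cons cl cls)
  have "\<forall>n\<in>fire e cl S. horn cls' n"
    using Cons.prems horn.step[of "fst cl" "snd cl" cls' e] unfolding fire_def by auto
  then show ?case using Cons by simp
qed simp

lemma stage_mono: "m \<le> n \<Longrightarrow> stage cls m \<subseteq> stage cls n"
proof (induction rule: dec_induct)
  case (step n)
  then show ?case
    using fold_fire_increasing[of "stage cls n" "decode_env (snd (prod_decode n))" cls]
    by auto
qed simp

text \<open>A clause has finitely many premises and variables, so some stage contains all premises
  and a later one applies the clause with a matching environment.\<close>

lemma horn_iff_stage: "horn cls n \<longleftrightarrow> (\<exists>k. n \<in> stage cls k)"
proof
  assume "horn cls n"
  then show "\<exists>k. n \<in> stage cls k"
  proof induction
    case (step ps c e)
    then obtain k where k: "\<And>p. p \<in> set ps \<Longrightarrow> pat_val e p \<in> stage cls (k p)" by metis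
    \<comment> \<open>All premises have appeared by stage \<open>K\<close>; the inserted 0 covers
      clauses without premises.\<close>
    define K where "K = Max (insert 0 (k ` set ps))"
    have K: "pat_val e p \<in> stage cls K'" if "p \<in> set ps" "K \<le> K'" for p K'
    proof -
      have "k p \<le> K" using that(1) unfolding K_def by auto
      then show ?thesis using k[OF that(1)] stage_mono[of "k p" K' cls] that(2) by auto
    qed
    obtain N where N: "\<And>p. p \<in> insert c (set ps) \<Longrightarrow> pat_bound p \<le> N"
      using finite_nat_set_iff_bounded_le[of "pat_bound ` insert c (set ps)"] by auto
    obtain d where d: "\<forall>i<N. decode_env d i = e i" using decode_env_surj by blast
    have eq: "pat_val (decode_env d) p = pat_val e p" if "p \<in> insert c (set ps)" for p
      using N[OF that] d by (intro pat_val_cong) auto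
    \<comment> \<open>\<open>K \<le> prod_encode (K, d)\<close> makes this stage late enough, and
      the second component supplies the environment \<open>d\<close>.\<close>
    let ?n = "prod_encode (K, d)"
    have "pat_val (decode_env d) c \<in> fold (fire (decode_env d)) cls (stage cls ?n)"
      by (rule fold_fire_derives[OF step(1)])
        (use K[of _ ?n] le_prod_encode_1 eq in auto)
    then have "pat_val e c \<in> stage cls (Suc ?n)" using eq by simp
    then show ?case by blast
  qed
next
  have "\<forall>n\<in>stage cls k. horn cls n" for k
    by (induction k) (auto dest: fold_fire_sound[OF subset_refl])
  then show "\<exists>k. n \<in> stage cls k \<Longrightarrow> horn cls n" by blast
qed

section \<open>Computability of the stages\<close>

lemma finite_stage: "finite (stage cls n)"
proof (induction n)
  case (Suc n)
  have "finite S \<Longrightarrow> finite (fold (fire e) cls S)" for S e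
    by (induction cls arbitrary: S) (auto simp: fire_def)
  with Suc show ?case by simp
qed simp

lemma total_rec_decode_env: "total_rec k A \<Longrightarrow> total_rec k (\<lambda>xs. decode_env (A xs) i)"
proof (induction i arbitrary: A)
  case 0
  then show ?case by (simp add: total_rec_fst_decode)
next
  case (Suc i)
  show ?case using Suc.IH[OF total_rec_snd_decode[OF Suc.prems]] by simp
qed

lemma total_rec_pat_val:
  "total_rec k A \<Longrightarrow> total_rec k (\<lambda>xs. pat_val (decode_env (A xs)) p)"
  by (induction p)
    (auto intro: total_rec_decode_env total_rec_prod_encode)

text \<open>A finite set is coded by binary digits, so membership is a parity test after division by
  a power of two.\<close>

lemma total_rec_pred_set_decode:
  assumes "total_rec k A" "total_rec k S"
  shows "total_rec_pred k (\<lambda>xs. A xs \<in> set_decode (S xs))"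
  unfolding set_decode_def mem_Collect_eq
  by (intro total_rec_pred_odd total_rec_div total_rec_power2 assms)

lemma total_rec_pred_Ball_list:
  "(\<And>p. p \<in> set ps \<Longrightarrow> total_rec_pred k (P p)) \<Longrightarrow> total_rec_pred k (\<lambda>xs. \<forall>p\<in>set ps. P p xs)"
proof (induction ps)
  case Nil
  then show ?case by (simp add: total_rec_pred_def total_rec_const)
next
  case (Cons p ps)
  then show ?case by (simp add: total_rec_pred_conj)
qed

text \<open>The clause list is fixed, so the fold unrolls into finitely many conditional updates of
  the code, while the environment varies with the arguments.\<close>

lemma total_rec_fold_fire:
  assumes A: "total_rec k A"
  shows "total_rec k S \<Longrightarrow>
    total_rec k (\<lambda>xs. set_encode (fold (fire (decode_env (A xs))) cls (set_decode (S xs))))"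
proof (induction cls arbitrary: S)
  case Nil
  then show ?case by simp
next
  case (Cons cl cls)
  \<comment> \<open>A new element adds one power of two; the inner test prevents adding it
    twice.\<close>
  define S' where "S' xs = (if \<forall>p\<in>set (fst cl). pat_val (decode_env (A xs)) p \<in> set_decode (S xs)
    then if pat_val (decode_env (A xs)) (snd cl) \<in> set_decode (S xs) then S xs
      else 2 ^ pat_val (decode_env (A xs)) (snd cl) + S xs
    else S xs)" for xs
  have "total_rec k S'"
    unfolding S'_def
    by (intro total_rec_if total_rec_pred_Ball_list total_rec_pred_set_decode total_rec_pat_val
        total_rec_add total_rec_power2 A Cons.prems)
  moreover have "set_decode (S' xs) = fire (decode_env (A xs)) cl (set_decode (S xs))" for xs
  proof -
    have "set_decode (2 ^ n + S xs) = insert n (set_decode (S xs))" if "n \<notin> set_decode (S xs)" for n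
      using set_encode_insert[OF finite_set_decode that] finite_set_decode[of "S xs"]
      by (metis finite_insert set_decode_inverse set_encode_inverse)
    then show ?thesis unfolding S'_def fire_def by auto
  qed
  ultimately show ?case using Cons.IH[of S'] by simp
qed

lemma total_rec_stage:
  assumes "total_rec k A" shows "total_rec k (\<lambda>xs. set_encode (stage cls (A xs)))"
proof -
  let ?g = "\<lambda>n y. set_encode (fold (fire (decode_env (snd (prod_decode n)))) cls (set_decode y))"
  have "rec_nat 0 ?g n = set_encode (stage cls n)" for n
    by (induction n) (simp_all add: finite_stage set_encode_inverse)
  moreover have "total_rec 2 (\<lambda>xs. ?g (xs ! 0) (xs ! 1))"
    by (intro total_rec_fold_fire total_rec_snd_decode total_rec_nth) auto
  then have "total_rec k (\<lambda>xs. rec_nat 0 ?g (A xs))"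
    by (intro total_rec_iterate[OF assms total_rec_const])
  ultimately show ?thesis by simp
qed

text \<open>Membership in a stage is decidable, and \<open>horn\<close> is the projection over all
  stages; the tag \<open>c\<close> selects one relation.\<close>

theorem recursively_enumerable_horn:
  "recursively_enumerable {n. horn cls (prod_encode (c, n))}"
proof -
  have "total_rec_pred 2 (\<lambda>xs. prod_encode (c, xs ! 1) \<in> set_decode (set_encode (stage cls (xs ! 0))))"
    by (intro total_rec_pred_set_decode total_rec_prod_encode total_rec_stage total_rec_const
        total_rec_nth) auto
  from recursively_enumerable_projection[OF this] show ?thesis
    by (simp add: finite_stage set_encode_inverse horn_iff_stage)
qed

section \<open>The calculus as a set of Horn clauses\<close>

lemma subst_tm_fresh: "x \<notin> vars_tm s \<Longrightarrow> subst_tm x t s = s"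
  by (induction s) (auto intro!: map_idI)

lemma subst_fresh: "x \<notin> free_vars A \<Longrightarrow> subst x t A = A"
  by (induction A) (auto intro!: map_idI subst_tm_fresh)

lemma free_for_fresh: "x \<notin> free_vars A \<Longrightarrow> free_for t x A"
  by (induction A) auto

lemmas lc_derivable = lc_axiom.intros[THEN derivable.lc]

text \<open>These patterns mirror the codings: a tag paired with its argument, a node with two
  children, and \<open>PC 0\<close> and \<open>cons_pat\<close> for the two forms of
  \<open>list_encode\<close>.\<close>

abbreviation fact_pat :: "nat \<Rightarrow> pat \<Rightarrow> pat" where "fact_pat k p \<equiv> PP (PC k) p"
abbreviation node_pat :: "nat \<Rightarrow> pat \<Rightarrow> pat \<Rightarrow> pat" where "node_pat k p q \<equiv> PP (PC k) (PP p q)"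
abbreviation var_pat :: "pat \<Rightarrow> pat" where "var_pat p \<equiv> PP (PC 0) p"
abbreviation cons_pat :: "pat \<Rightarrow> pat \<Rightarrow> pat" where "cons_pat p q \<equiv> PS (PP p q)"
abbreviation bot_pat :: pat where "bot_pat \<equiv> PP (PC 0) (PC 0)"
abbreviation pair_pat :: "pat \<Rightarrow> pat \<Rightarrow> pat" where "pair_pat p q \<equiv> PP p q"
abbreviation quad_pat :: "pat \<Rightarrow> pat \<Rightarrow> pat \<Rightarrow> pat \<Rightarrow> pat" where
  "quad_pat p q r s \<equiv> PP p (PP q (PP r s))"

text \<open>
  The tag of a fact names its relation: 0 distinct numbers, 1 term, 2 term list, 3 formula,
  5/6/7 variable not free in a term/term list/formula, 8/9/10 graph of substitution in a
  term/term list/formula (the last one restricted by \<open>free_for\<close>), 11 quantifier-free,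
  12 prenex, 13 derivable, 14 prenex and derivable.
\<close>

definition syntax_clauses :: "(pat list \<times> pat) list" where
  "syntax_clauses = (let a = PV 0; b = PV 1; c = PV 2; d = PV 3; e = PV 4; f = PV 5 in
    [([], fact_pat 0 (pair_pat (PC 0) (PS a))),
     ([], fact_pat 0 (pair_pat (PS a) (PC 0))),
     ([fact_pat 0 (pair_pat a b)], fact_pat 0 (pair_pat (PS a) (PS b))),
     ([], fact_pat 1 (var_pat a)),
     ([fact_pat 2 b], fact_pat 1 (node_pat 1 a b)),
     ([], fact_pat 2 (PC 0)),
     ([fact_pat 1 a, fact_pat 2 b], fact_pat 2 (cons_pat a b)),
     ([], fact_pat 3 bot_pat),
     ([fact_pat 2 b], fact_pat 3 (node_pat 1 a b)),
     ([fact_pat 0 (pair_pat a b)], fact_pat 5 (pair_pat a (var_pat b))),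
     ([fact_pat 6 (pair_pat a c)], fact_pat 5 (pair_pat a (node_pat 1 b c))),
     ([], fact_pat 6 (pair_pat a (PC 0))),
     ([fact_pat 5 (pair_pat a b), fact_pat 6 (pair_pat a c)],
        fact_pat 6 (pair_pat a (cons_pat b c))),
     ([], fact_pat 7 (pair_pat a bot_pat)),
     ([fact_pat 6 (pair_pat a c)], fact_pat 7 (pair_pat a (node_pat 1 b c))),
     ([fact_pat 1 b], fact_pat 8 (quad_pat a b (var_pat a) b)),
     ([fact_pat 1 b, fact_pat 0 (pair_pat a c)],
        fact_pat 8 (quad_pat a b (var_pat c) (var_pat c))),
     ([fact_pat 9 (quad_pat a b d e)],
        fact_pat 8 (quad_pat a b (node_pat 1 c d) (node_pat 1 c e))),
     ([fact_pat 1 b], fact_pat 9 (quad_pat a b (PC 0) (PC 0))),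
     ([fact_pat 8 (quad_pat a b c d), fact_pat 9 (quad_pat a b e f)],
        fact_pat 9 (quad_pat a b (cons_pat c e) (cons_pat d f))),
     ([fact_pat 1 b, fact_pat 7 (pair_pat a c)], fact_pat 10 (quad_pat a b c c)),
     ([fact_pat 9 (quad_pat a b d e)],
        fact_pat 10 (quad_pat a b (node_pat 1 c d) (node_pat 1 c e))),
     ([], fact_pat 11 bot_pat),
     ([fact_pat 2 b], fact_pat 11 (node_pat 1 a b)),
     ([fact_pat 11 a], fact_pat 12 a)] @
    concat (map (\<lambda>k.
    [([fact_pat 3 a, fact_pat 3 b], fact_pat 3 (node_pat k a b)),
     ([fact_pat 7 (pair_pat a b), fact_pat 7 (pair_pat a c)],
        fact_pat 7 (pair_pat a (node_pat k b c))),
     ([fact_pat 10 (quad_pat a b c d), fact_pat 10 (quad_pat a b e f)],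
        fact_pat 10 (quad_pat a b (node_pat k c e) (node_pat k d f))),
     ([fact_pat 11 a, fact_pat 11 b], fact_pat 11 (node_pat k a b))]) [2, 3, 4]) @
    concat (map (\<lambda>k.
    [([fact_pat 3 b], fact_pat 3 (node_pat k a b)),
     ([fact_pat 3 b], fact_pat 7 (pair_pat a (node_pat k a b))),
     ([fact_pat 7 (pair_pat a c)], fact_pat 7 (pair_pat a (node_pat k b c))),
     ([fact_pat 5 (pair_pat c b), fact_pat 0 (pair_pat a c), fact_pat 10 (quad_pat a b d e)],
        fact_pat 10 (quad_pat a b (node_pat k c d) (node_pat k c e))),
     ([fact_pat 12 b], fact_pat 12 (node_pat k a b))]) [5, 6]))"

text \<open>Premises with tag 3 make metavariables range over formulas. Absence of capture is part
  of tag 10, and tag 7 expresses the conditions on eigenvariables and on shifting.\<close>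

definition derivation_clauses :: "(pat list \<times> pat) list" where
  "derivation_clauses = (let a = PV 0; b = PV 1; c = PV 2; x = PV 3; t = PV 4;
      conj = node_pat 2; dis = node_pat 3; imp = node_pat 4 in
    map (\<lambda>p. ([fact_pat 3 a, fact_pat 3 b, fact_pat 3 c], fact_pat 13 p))
     [imp a (imp b a),
      imp (imp a (imp b c)) (imp (imp a b) (imp a c)),
      imp (conj a b) a,
      imp (conj a b) b,
      imp a (imp b (conj a b)),
      imp a (dis a b),
      imp b (dis a b),
      imp (imp a c) (imp (imp b c) (imp (dis a b) c)),
      imp bot_pat a,
      dis (imp a b) (imp b a)] @
    [([fact_pat 13 (imp a b), fact_pat 13 a], fact_pat 13 b),
     ([fact_pat 10 (quad_pat x (var_pat t) a b), fact_pat 13 b,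
        fact_pat 7 (pair_pat t (node_pat 5 x a))], fact_pat 13 (node_pat 5 x a)),
     ([fact_pat 10 (quad_pat x t a b), fact_pat 13 b], fact_pat 13 (node_pat 6 x a)),
     ([fact_pat 13 (node_pat 5 x (dis a b)), fact_pat 7 (pair_pat x b)],
        fact_pat 13 (dis (node_pat 5 x a) b)),
     ([fact_pat 13 (node_pat 6 x (dis a b)), fact_pat 7 (pair_pat x b)],
        fact_pat 13 (dis (node_pat 6 x a) b)),
     ([fact_pat 12 a, fact_pat 13 a], fact_pat 14 a)])"

fun big_disj_pat :: "pat list \<Rightarrow> pat" where
  "big_disj_pat [] = bot_pat"
| "big_disj_pat [p] = p"
| "big_disj_pat (p # q # ps) = node_pat 3 p (big_disj_pat (q # ps))"

text \<open>For fixed \<open>m\<close> the schema is a single clause, its metavariables being the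
  pattern variables.\<close>

definition finite_axiom_clause :: "nat \<Rightarrow> pat list \<times> pat" where
  "finite_axiom_clause m = (map (\<lambda>i. fact_pat 3 (PV i)) [0..<m + 2],
     fact_pat 13 (big_disj_pat (map (\<lambda>i. big_disj_pat
       (map (\<lambda>j. node_pat 2 (node_pat 4 (PV i) (PV j)) (node_pat 4 (PV j) (PV i)))
         [i + 1..<m + 2])) [1..<m + 1])))"

text \<open>\<open>None\<close> stands for the calculus without the finiteness schema,
  \<open>Some m\<close> for the one with the schema for \<open>m\<close> values.\<close>

definition calculus_clauses :: "nat option \<Rightarrow> (pat list \<times> pat) list" where
  "calculus_clauses m = syntax_clauses @ derivation_clauses @
     (case m of None \<Rightarrow> [] | Some m \<Rightarrow> [finite_axiom_clause m])"

definition calculus_axioms :: "nat option \<Rightarrow> fm set" where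
  "calculus_axioms m = (case m of None \<Rightarrow> {} | Some m \<Rightarrow> range (finite_axiom m))"

section \<open>Inversion of codes and soundness of the clauses\<close>

lemma code_tm_eq_iff [simp]: "code_tm s = code_tm t \<longleftrightarrow> s = t"
  using code_tm_inject by blast

lemma code_fm_eq_iff [simp]: "code_fm A = code_fm B \<longleftrightarrow> A = B"
  using code_fm_inject by blast

abbreviation code_tms :: "tm list \<Rightarrow> nat" where
  "code_tms ts \<equiv> list_encode (map code_tm ts)"

lemma code_tms_eq_iff [simp]: "code_tms ss = code_tms ts \<longleftrightarrow> ss = ts"
  by (simp add: list_encode_eq inj_map_eq_map inj_def)

text \<open>If a number with a known tag is a code, the tag determines the outermost constructor.
  This turns facts about patterns into facts about syntax.\<close>

lemma node_eq_code:
  "prod_encode (0, n) = code_tm t \<longleftrightarrow> t = Var n"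
  "prod_encode (Suc 0, prod_encode (n, k)) = code_tm t \<longleftrightarrow> (\<exists>ts. t = Fn n ts \<and> k = code_tms ts)"
  "0 = code_tms ts \<longleftrightarrow> ts = []"
  "Suc (prod_encode (n, k)) = code_tms ts \<longleftrightarrow>
     (\<exists>t ts'. ts = t # ts' \<and> n = code_tm t \<and> k = code_tms ts')"
  "prod_encode (0, 0) = code_fm A \<longleftrightarrow> A = Bot"
  "prod_encode (Suc 0, prod_encode (n, k)) = code_fm A \<longleftrightarrow> (\<exists>ts. A = Pr n ts \<and> k = code_tms ts)"
  "prod_encode (2, prod_encode (n, k)) = code_fm A \<longleftrightarrow>
     (\<exists>B C. A = Conj B C \<and> n = code_fm B \<and> k = code_fm C)"
  "prod_encode (3, prod_encode (n, k)) = code_fm A \<longleftrightarrow>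
     (\<exists>B C. A = Dis B C \<and> n = code_fm B \<and> k = code_fm C)"
  "prod_encode (4, prod_encode (n, k)) = code_fm A \<longleftrightarrow>
     (\<exists>B C. A = Imp B C \<and> n = code_fm B \<and> k = code_fm C)"
  "prod_encode (5, prod_encode (n, k)) = code_fm A \<longleftrightarrow> (\<exists>B. A = All n B \<and> k = code_fm B)"
  "prod_encode (6, prod_encode (n, k)) = code_fm A \<longleftrightarrow> (\<exists>B. A = Ex n B \<and> k = code_fm B)"
  by (cases t; auto; fail | cases ts; auto; fail | cases A; auto; fail)+

lemma code_big_disj:
  "(\<And>i. i \<in> set is \<Longrightarrow> pat_val e (f i) = code_fm (g i)) \<Longrightarrow>
    pat_val e (big_disj_pat (map f is)) = code_fm (big_disj (map g is))"
  by (induction "is" rule: induct_list012) auto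

lemma code_finite_axiom:
  assumes "\<And>i. i < m + 2 \<Longrightarrow> e i = code_fm (A i)"
  shows "pat_val e (snd (finite_axiom_clause m)) = prod_encode (13, code_fm (finite_axiom m A))"
proof -
  have "pat_val e (big_disj_pat (map (\<lambda>i. big_disj_pat
       (map (\<lambda>j. node_pat 2 (node_pat 4 (PV i) (PV j)) (node_pat 4 (PV j) (PV i)))
         [i + 1..<m + 2])) [1..<m + 1])) = code_fm (finite_axiom m A)"
    unfolding finite_axiom_def
    by (intro code_big_disj) (auto simp: assms simp del: upt_Suc)
  then show ?thesis by (simp add: finite_axiom_clause_def)
qed

text \<open>The intended reading of a coded fact. The argument is decoded to the depth of a
  quadruple in advance and each tag takes the components it needs; the final branch serves tag
  14.\<close>

definition fact_true :: "fm set \<Rightarrow> nat \<Rightarrow> bool" where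
  "fact_true X n = (let (k, m) = prod_decode n; (x, l) = prod_decode m;
      (t, r) = prod_decode l; (s, u) = prod_decode r in
    if k = 0 then x \<noteq> l
    else if k = 1 then \<exists>t. m = code_tm t
    else if k = 2 then \<exists>ts. m = code_tms ts
    else if k = 3 then \<exists>A. m = code_fm A
    else if k = 5 then \<exists>t. l = code_tm t \<and> x \<notin> vars_tm t
    else if k = 6 then \<exists>ts. l = code_tms ts \<and> (\<forall>t\<in>set ts. x \<notin> vars_tm t)
    else if k = 7 then \<exists>A. l = code_fm A \<and> x \<notin> free_vars A
    else if k = 8 then \<exists>t' s'. t = code_tm t' \<and> s = code_tm s' \<and> u = code_tm (subst_tm x t' s')
    else if k = 9 then \<exists>t' ss. t = code_tm t' \<and> s = code_tms ss \<and> u = code_tms (map (subst_tm x t') ss)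
    else if k = 10 then \<exists>t' A. t = code_tm t' \<and> s = code_fm A \<and> u = code_fm (subst x t' A) \<and> free_for t' x A
    else if k = 11 then \<exists>A. m = code_fm A \<and> quantifier_free A
    else if k = 12 then \<exists>A. m = code_fm A \<and> prenex A
    else if k = 13 then \<exists>A. m = code_fm A \<and> derivable X A
    else \<exists>A. m = code_fm A \<and> prenex A \<and> derivable X A)"

lemma fact_true_simps [simp]:
  "fact_true X (prod_encode (0, prod_encode (x, l))) \<longleftrightarrow> x \<noteq> l"
  "fact_true X (prod_encode (Suc 0, m)) \<longleftrightarrow> (\<exists>t. m = code_tm t)"
  "fact_true X (prod_encode (2, m)) \<longleftrightarrow> (\<exists>ts. m = code_tms ts)"
  "fact_true X (prod_encode (3, m)) \<longleftrightarrow> (\<exists>A. m = code_fm A)"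
  "fact_true X (prod_encode (5, prod_encode (x, l))) \<longleftrightarrow> (\<exists>t. l = code_tm t \<and> x \<notin> vars_tm t)"
  "fact_true X (prod_encode (6, prod_encode (x, l))) \<longleftrightarrow>
     (\<exists>ts. l = code_tms ts \<and> (\<forall>t\<in>set ts. x \<notin> vars_tm t))"
  "fact_true X (prod_encode (7, prod_encode (x, l))) \<longleftrightarrow> (\<exists>A. l = code_fm A \<and> x \<notin> free_vars A)"
  "fact_true X (prod_encode (8, prod_encode (x, prod_encode (t, prod_encode (s, u))))) \<longleftrightarrow>
     (\<exists>t' s'. t = code_tm t' \<and> s = code_tm s' \<and> u = code_tm (subst_tm x t' s'))"
  "fact_true X (prod_encode (9, prod_encode (x, prod_encode (t, prod_encode (s, u))))) \<longleftrightarrow>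
     (\<exists>t' ss. t = code_tm t' \<and> s = code_tms ss \<and> u = code_tms (map (subst_tm x t') ss))"
  "fact_true X (prod_encode (10, prod_encode (x, prod_encode (t, prod_encode (s, u))))) \<longleftrightarrow>
     (\<exists>t' A. t = code_tm t' \<and> s = code_fm A \<and> u = code_fm (subst x t' A) \<and> free_for t' x A)"
  "fact_true X (prod_encode (11, m)) \<longleftrightarrow> (\<exists>A. m = code_fm A \<and> quantifier_free A)"
  "fact_true X (prod_encode (12, m)) \<longleftrightarrow> (\<exists>A. m = code_fm A \<and> prenex A)"
  "fact_true X (prod_encode (13, m)) \<longleftrightarrow> (\<exists>A. m = code_fm A \<and> derivable X A)"
  "fact_true X (prod_encode (14, m)) \<longleftrightarrow> (\<exists>A. m = code_fm A \<and> prenex A \<and> derivable X A)"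
  unfolding fact_true_def by (simp_all add: case_prod_beta)

lemma syntax_clauses_sound:
  "(ps, c) \<in> set syntax_clauses \<Longrightarrow> \<forall>p\<in>set ps. fact_true X (pat_val e p) \<Longrightarrow>
    fact_true X (pat_val e c)"
  unfolding syntax_clauses_def Let_def
  by (simp del: list_encode.simps map_map, elim disjE conjE)
    (auto simp: node_eq_code subst_fresh free_for_fresh prenex.intros)

lemma derivation_clauses_sound:
  "(ps, c) \<in> set derivation_clauses \<Longrightarrow> \<forall>p\<in>set ps. fact_true X (pat_val e p) \<Longrightarrow>
    fact_true X (pat_val e c)"
  \<comment> \<open>The eigenvariable \<open>e 4\<close> of the generalization clause may coincide
    with the quantified variable \<open>e 3\<close>; the two instances of
    \<open>derivable.all_intro\<close> provide for both possibilities.\<close>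
  unfolding derivation_clauses_def Let_def
  by (simp del: list_encode.simps map_map, elim disjE conjE)
    (auto simp: node_eq_code lc_derivable dest: derivable.mp
      intro: derivable.ex_intro derivable.all_shift derivable.ex_shift
        derivable.all_intro[of _ _ "e 4", simplified] derivable.all_intro[of _ _ "e 3"])

lemma horn_calculus_sound: "horn (calculus_clauses m) n \<Longrightarrow> fact_true (calculus_axioms m) n"
proof (induction rule: horn.induct)
  case (step ps c e)
  have IH: "\<forall>p\<in>set ps. fact_true (calculus_axioms m) (pat_val e p)" using step(2) by blast
  consider "(ps, c) \<in> set syntax_clauses" | "(ps, c) \<in> set derivation_clauses"
    | k where "m = Some k" "(ps, c) = finite_axiom_clause k"
    using step(1) unfolding calculus_clauses_def by (auto split: option.splits)
  then show ?case
  proof cases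
    case 3
    \<comment> \<open>Only values below \<open>k + 2\<close> are certified as formulas by the
      premises; elsewhere the choice is arbitrary.\<close>
    have "\<exists>A. i < k + 2 \<longrightarrow> e i = code_fm A" for i
      using IH 3(2) by (auto simp: finite_axiom_clause_def simp del: upt_Suc)
    then obtain A where A: "\<And>i. i < k + 2 \<Longrightarrow> e i = code_fm (A i)" by metis
    have "derivable (calculus_axioms m) (finite_axiom k A)"
      using 3(1) by (auto simp: calculus_axioms_def intro: derivable.extra)
    then show ?thesis using code_finite_axiom[of k e A, OF A] 3(2)[symmetric] by auto
  qed (use IH syntax_clauses_sound derivation_clauses_sound in blast)+
qed

text \<open>Treats a whole clause list at once, so that simplification can split it into one
  introduction rule per clause.\<close>

lemma horn_closed:
  "set cls \<subseteq> set cls' \<Longrightarrow>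
    \<forall>(ps, c)\<in>set cls. (\<forall>p\<in>set ps. horn cls' (pat_val e p)) \<longrightarrow> horn cls' (pat_val e c)"
  using horn.step[of _ _ cls'] by blast

section \<open>Completeness of the syntax clauses\<close>

context
  fixes C :: "(pat list \<times> pat) list"
  assumes C: "set syntax_clauses \<subseteq> set C"
begin

text \<open>Reading the environment off a list lets simplification evaluate every
  \<open>PV i\<close>, which leaves rules with ordinary variables.\<close>

lemma syntax_rules:
  fixes a b c d e f :: nat
  defines "env \<equiv> (!) [a, b, c, d, e, f]"
  shows "\<forall>(ps, r)\<in>set syntax_clauses. (\<forall>p\<in>set ps. horn C (pat_val env p)) \<longrightarrow> horn C (pat_val env r)"
  using horn_closed[OF C] .

lemmas syntax_intros = syntax_rules[unfolded syntax_clauses_def Let_def, simplified]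

lemma horn_neq: "x \<noteq> y \<Longrightarrow> horn C (prod_encode (0, prod_encode (x, y)))"
proof (induction x arbitrary: y)
  case 0
  then show ?case by (cases y) (auto simp: syntax_intros)
next
  case (Suc x)
  then show ?case by (cases y) (auto simp: syntax_intros)
qed

lemma horn_tms: "\<forall>t\<in>set ts. horn C (prod_encode (1, code_tm t)) \<Longrightarrow>
    horn C (prod_encode (2, code_tms ts))"
  by (induction ts) (simp_all add: syntax_intros)

lemma horn_tm: "horn C (prod_encode (1, code_tm t))"
proof (induction t)
  case (Fn f ts)
  then show ?case using horn_tms[of ts] by (simp add: syntax_intros)
qed (simp add: syntax_intros)

lemma horn_fm: "horn C (prod_encode (3, code_fm A))"
  using horn_tms horn_tm by (induction A) (simp_all add: syntax_intros)

lemma horn_not_free_tms: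
  "\<forall>t\<in>set ts. horn C (prod_encode (5, prod_encode (x, code_tm t))) \<Longrightarrow>
    horn C (prod_encode (6, prod_encode (x, code_tms ts)))"
  by (induction ts) (simp_all add: syntax_intros)

lemma horn_not_free_tm:
  "x \<notin> vars_tm t \<Longrightarrow> horn C (prod_encode (5, prod_encode (x, code_tm t)))"
proof (induction t)
  case (Fn f ts)
  then show ?case using horn_not_free_tms[of ts x] by (simp add: syntax_intros)
qed (simp add: syntax_intros horn_neq)

lemma horn_not_free:
  "x \<notin> free_vars A \<Longrightarrow> horn C (prod_encode (7, prod_encode (x, code_fm A)))"
proof (induction A)
  case (Pr p ts)
  then show ?case using horn_not_free_tms[of ts x] horn_not_free_tm by (simp add: syntax_intros)
next
  case (All y A)
  then show ?case using horn_fm[of A] by (cases "x = y") (simp_all add: syntax_intros)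
next
  case (Ex y A)
  then show ?case using horn_fm[of A] by (cases "x = y") (simp_all add: syntax_intros)
qed (simp_all add: syntax_intros)

lemma horn_subst_tms:
  "\<forall>s\<in>set ss. horn C (prod_encode (8, prod_encode (x, prod_encode (code_tm t,
      prod_encode (code_tm s, code_tm (subst_tm x t s)))))) \<Longrightarrow>
    horn C (prod_encode (9, prod_encode (x, prod_encode (code_tm t,
      prod_encode (code_tms ss, code_tms (map (subst_tm x t) ss))))))"
  using horn_tm[of t] by (induction ss) (simp_all add: syntax_intros)

lemma horn_subst_tm:
  "horn C (prod_encode (8, prod_encode (x, prod_encode (code_tm t,
      prod_encode (code_tm s, code_tm (subst_tm x t s))))))"
proof (induction s)
  case (Var y)
  then show ?case using horn_tm[of t] horn_neq[of x y] by (simp add: syntax_intros)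
next
  case (Fn f ss)
  then show ?case using horn_subst_tms[of ss x t] by (simp add: syntax_intros)
qed

text \<open>If \<open>x\<close> is free in a quantified formula, \<open>free_for\<close> makes the
  bound variable different from \<open>x\<close> on top of its absence from \<open>t\<close>, so the
  quantifier clause applies. Otherwise substitution is the identity and the freshness clause
  applies.\<close>

lemma horn_subst:
  "free_for t x A \<Longrightarrow> horn C (prod_encode (10, prod_encode (x, prod_encode (code_tm t,
      prod_encode (code_fm A, code_fm (subst x t A))))))"
proof (induction A)
  case Bot
  then show ?case using horn_tm[of t] by (simp add: syntax_intros)
next
  case (Pr p ts)
  then show ?case
    using horn_subst_tms[of ts x t] horn_subst_tm[of x t] by (simp add: syntax_intros)
next
  case (All y A)
  show ?case
  proof (cases "x \<in> free_vars (All y A)")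
    case True
    then show ?thesis
      using All horn_not_free_tm[of y t] horn_neq[of x y] by (simp add: syntax_intros)
  next
    case False
    then show ?thesis
      using horn_not_free[OF False] horn_tm[of t] by (simp only: subst_fresh[OF False] syntax_intros One_nat_def)
  qed
next
  case (Ex y A)
  show ?case
  proof (cases "x \<in> free_vars (Ex y A)")
    case True
    then show ?thesis
      using Ex horn_not_free_tm[of y t] horn_neq[of x y] by (simp add: syntax_intros)
  next
    case False
    then show ?thesis
      using horn_not_free[OF False] horn_tm[of t] by (simp only: subst_fresh[OF False] syntax_intros One_nat_def)
  qed
qed (simp_all add: syntax_intros)

lemma horn_quantifier_free: "quantifier_free A \<Longrightarrow> horn C (prod_encode (11, code_fm A))"
  using horn_tms horn_tm by (induction A) (simp_all add: syntax_intros)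

lemma horn_prenex: "prenex A \<Longrightarrow> horn C (prod_encode (12, code_fm A))"
  by (induction rule: prenex.induct) (simp_all add: syntax_intros horn_quantifier_free)

end

section \<open>Completeness of the derivation clauses\<close>

context
  fixes C :: "(pat list \<times> pat) list"
  assumes syntax_cls: "set syntax_clauses \<subseteq> set C"
    and derivation_cls: "set derivation_clauses \<subseteq> set C"
begin

lemma derivation_rules:
  fixes a b c x t :: nat
  defines "env \<equiv> (!) [a, b, c, x, t]"
  shows "\<forall>(ps, r)\<in>set derivation_clauses.
    (\<forall>p\<in>set ps. horn C (pat_val env p)) \<longrightarrow> horn C (pat_val env r)"
  using horn_closed[OF derivation_cls] .

lemmas derivation_intros = derivation_rules[unfolded derivation_clauses_def Let_def, simplified]

lemma horn_lc_axiom: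
  assumes "lc_axiom F" shows "horn C (prod_encode (13, code_fm F))"
proof -
  have "horn C (prod_encode (13, code_fm (Imp A (Imp B A)))) \<and>
    horn C (prod_encode (13, code_fm (Imp (Imp A (Imp B D)) (Imp (Imp A B) (Imp A D))))) \<and>
    horn C (prod_encode (13, code_fm (Imp (Conj A B) A))) \<and>
    horn C (prod_encode (13, code_fm (Imp (Conj A B) B))) \<and>
    horn C (prod_encode (13, code_fm (Imp A (Imp B (Conj A B))))) \<and>
    horn C (prod_encode (13, code_fm (Imp A (Dis A B)))) \<and>
    horn C (prod_encode (13, code_fm (Imp B (Dis A B)))) \<and>
    horn C (prod_encode (13, code_fm (Imp (Imp A D) (Imp (Imp B D) (Imp (Dis A B) D))))) \<and>
    horn C (prod_encode (13, code_fm (Imp Bot A))) \<and>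
    horn C (prod_encode (13, code_fm (Dis (Imp A B) (Imp B A))))" for A B D
    using derivation_intros[of "code_fm A" "code_fm B" "code_fm D" 0 0]
      horn_fm[OF syntax_cls, of A] horn_fm[OF syntax_cls, of B] horn_fm[OF syntax_cls, of D]
    unfolding code_fm.simps by blast
  with assms show ?thesis by (cases rule: lc_axiom.cases) blast+
qed

lemma horn_derivation_rules:
  "horn C (prod_encode (13, prod_encode (4, prod_encode (a, b)))) \<Longrightarrow>
    horn C (prod_encode (13, a)) \<Longrightarrow> horn C (prod_encode (13, b))"
  "horn C (prod_encode (10, prod_encode (x, prod_encode (prod_encode (0, t), prod_encode (a, b))))) \<Longrightarrow>
    horn C (prod_encode (13, b)) \<Longrightarrow>
    horn C (prod_encode (7, prod_encode (t, prod_encode (5, prod_encode (x, a))))) \<Longrightarrow>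
    horn C (prod_encode (13, prod_encode (5, prod_encode (x, a))))"
  "horn C (prod_encode (10, prod_encode (x, prod_encode (t, prod_encode (a, b))))) \<Longrightarrow>
    horn C (prod_encode (13, b)) \<Longrightarrow> horn C (prod_encode (13, prod_encode (6, prod_encode (x, a))))"
  "horn C (prod_encode (13, prod_encode (5, prod_encode (x, prod_encode (3, prod_encode (a, b)))))) \<Longrightarrow>
    horn C (prod_encode (7, prod_encode (x, b))) \<Longrightarrow>
    horn C (prod_encode (13, prod_encode (3, prod_encode (prod_encode (5, prod_encode (x, a)), b))))"
  "horn C (prod_encode (13, prod_encode (6, prod_encode (x, prod_encode (3, prod_encode (a, b)))))) \<Longrightarrow>
    horn C (prod_encode (7, prod_encode (x, b))) \<Longrightarrow>
    horn C (prod_encode (13, prod_encode (3, prod_encode (prod_encode (6, prod_encode (x, a)), b))))"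
  "horn C (prod_encode (12, a)) \<Longrightarrow> horn C (prod_encode (13, a)) \<Longrightarrow> horn C (prod_encode (14, a))"
  using derivation_intros[of a b 0 x t] by simp_all

lemma horn_derivable:
  assumes "\<And>A. A \<in> X \<Longrightarrow> horn C (prod_encode (13, code_fm A))"
  shows "derivable X A \<Longrightarrow> horn C (prod_encode (13, code_fm A))"
proof (induction rule: derivable.induct)
  case (mp A B)
  then show ?case using horn_derivation_rules(1)[where a = "code_fm A" and b = "code_fm B"] by simp
next
  case (all_intro x y A)
  show ?case
    using horn_derivation_rules(2)[where x = x and t = y and a = "code_fm A"
        and b = "code_fm (subst x (Var y) A)"]
      all_intro.IH horn_subst[OF syntax_cls all_intro.hyps(2)]
      horn_not_free[OF syntax_cls all_intro.hyps(3)] by simp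
next
  case (ex_intro x t A)
  show ?case
    using horn_derivation_rules(3)[where x = x and t = "code_tm t" and a = "code_fm A"
        and b = "code_fm (subst x t A)"]
      ex_intro.IH horn_subst[OF syntax_cls ex_intro.hyps(2)] by simp
next
  case (all_shift x A B)
  show ?case
    using horn_derivation_rules(4)[where x = x and a = "code_fm A" and b = "code_fm B"]
      all_shift.IH horn_not_free[OF syntax_cls all_shift.hyps(2)]
    by simp
next
  case (ex_shift x A B)
  show ?case
    using horn_derivation_rules(5)[where x = x and a = "code_fm A" and b = "code_fm B"]
      ex_shift.IH horn_not_free[OF syntax_cls ex_shift.hyps(2)]
    by simp
qed (use assms horn_lc_axiom in blast)+

lemma horn_prenex_derivable:
  assumes "horn C (prod_encode (13, code_fm A))" and "prenex A"
  shows "horn C (prod_encode (14, code_fm A))"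
  using horn_derivation_rules(6)[OF horn_prenex[OF syntax_cls assms(2)] assms(1)] .

end

text \<open>Tag 14 marks exactly the wanted codes: completeness of the clauses gives one inclusion,
  their soundness the other.\<close>

theorem axiomatizable_prenex_derivable:
  "axiomatizable {A. prenex A \<and> derivable (calculus_axioms m) A}"
proof -
  let ?C = "calculus_clauses m"
  have syntax_cls: "set syntax_clauses \<subseteq> set ?C" and derivation_cls: "set derivation_clauses \<subseteq> set ?C"
    unfolding calculus_clauses_def by auto
  have axioms: "horn ?C (prod_encode (13, code_fm A))" if A: "A \<in> calculus_axioms m" for A
  proof -
    obtain k B where k: "m = Some k" and B: "A = finite_axiom k B"
      using A unfolding calculus_axioms_def by (auto split: option.splits)
    have "horn ?C (pat_val (\<lambda>i. code_fm (B i)) (snd (finite_axiom_clause k)))"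
      using horn_fm[OF syntax_cls] unfolding k
      by (intro horn.step[where ps = "fst (finite_axiom_clause k)"])
        (auto simp: calculus_clauses_def finite_axiom_clause_def simp del: upt_Suc)
    then show ?thesis using code_finite_axiom[of k "\<lambda>i. code_fm (B i)" B] B by simp
  qed
  have "code_fm ` {A. prenex A \<and> derivable (calculus_axioms m) A} =
    {n. horn ?C (prod_encode (14, n))}"
  proof safe
    fix A assume "prenex A" "derivable (calculus_axioms m) A"
    then show "horn ?C (prod_encode (14, code_fm A))"
      using horn_prenex_derivable[OF syntax_cls derivation_cls]
        horn_derivable[OF syntax_cls derivation_cls axioms] by blast
  next
    fix n assume "horn ?C (prod_encode (14, n))"
    from horn_calculus_sound[OF this]
    show "n \<in> code_fm ` {A. prenex A \<and> derivable (calculus_axioms m) A}" by auto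
  qed
  then show ?thesis
    unfolding axiomatizable_def using recursively_enumerable_horn by simp
qed

section \<open>Soundness\<close>

lemma eval_tm_cong:
  assumes "FnI I = FnI J"
  shows "(\<And>x. x \<in> vars_tm t \<Longrightarrow> VarI I x = VarI J x) \<Longrightarrow> eval_tm I t = eval_tm J t"
proof (induction t)
  case (Fn f ts)
  then have "map (eval_tm I) ts = map (eval_tm J) ts" by auto
  then show ?case using assms by (simp only: eval_tm.simps)
qed simp

lemma eval_cong:
  "Dom I = Dom J \<Longrightarrow> FnI I = FnI J \<Longrightarrow> PrI I = PrI J \<Longrightarrow>
    (\<And>x. x \<in> free_vars A \<Longrightarrow> VarI I x = VarI J x) \<Longrightarrow> eval A I = eval A J"
proof (induction A arbitrary: I J)
  case (Pr p ts)
  then have "map (eval_tm I) ts = map (eval_tm J) ts" by (auto intro!: eval_tm_cong)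
  then show ?case using Pr.prems(3) by (simp only: eval.simps)
next
  case (Conj A B)
  have "eval A I = eval A J" by (rule Conj.IH(1)) (use Conj.prems in auto)
  moreover have "eval B I = eval B J" by (rule Conj.IH(2)) (use Conj.prems in auto)
  ultimately show ?case by simp
next
  case (Dis A B)
  have "eval A I = eval A J" by (rule Dis.IH(1)) (use Dis.prems in auto)
  moreover have "eval B I = eval B J" by (rule Dis.IH(2)) (use Dis.prems in auto)
  ultimately show ?case by simp
next
  case (Imp A B)
  have "eval A I = eval A J" by (rule Imp.IH(1)) (use Imp.prems in auto)
  moreover have "eval B I = eval B J" by (rule Imp.IH(2)) (use Imp.prems in auto)
  ultimately show ?case by simp
next
  case (All x A)
  have "eval A (I\<lparr>VarI := (VarI I)(x := d)\<rparr>) = eval A (J\<lparr>VarI := (VarI J)(x := d)\<rparr>)" for d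
    by (rule All.IH) (use All.prems in auto)
  then show ?case using All.prems by simp
next
  case (Ex x A)
  have "eval A (I\<lparr>VarI := (VarI I)(x := d)\<rparr>) = eval A (J\<lparr>VarI := (VarI J)(x := d)\<rparr>)" for d
    by (rule Ex.IH) (use Ex.prems in auto)
  then show ?case using Ex.prems by simp
qed simp

lemma eval_subst_tm:
  assumes "FnI J = FnI I" "VarI J x = eval_tm I t" "\<And>y. y \<noteq> x \<Longrightarrow> VarI J y = VarI I y"
  shows "eval_tm I (subst_tm x t s) = eval_tm J s"
proof (induction s)
  case (Fn f ts)
  then have "map (eval_tm I) (map (subst_tm x t) ts) = map (eval_tm J) ts" by simp
  then show ?case using assms by (simp only: subst_tm.simps eval_tm.simps)
qed (use assms in auto)

text \<open>\<open>J\<close> is described by its properties and not as an update of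
  \<open>I\<close>: below a quantifier both interpretations are updated, and the description
  survives this.\<close>

lemma eval_subst_aux:
  "free_for t x A \<Longrightarrow> Dom J = Dom I \<Longrightarrow> FnI J = FnI I \<Longrightarrow> PrI J = PrI I \<Longrightarrow>
    VarI J x = eval_tm I t \<Longrightarrow> (\<And>y. y \<noteq> x \<Longrightarrow> VarI J y = VarI I y) \<Longrightarrow>
    eval (subst x t A) I = eval A J"
proof (induction A arbitrary: I J)
  case (Pr p ts)
  have "map (eval_tm I) (map (subst_tm x t) ts) = map (eval_tm J) ts"
    using eval_subst_tm[of J I x t] Pr.prems by simp
  then show ?case using Pr.prems(4) by (simp only: subst.simps eval.simps)
next
  case (Conj A B)
  have "eval (subst x t A) I = eval A J" by (rule Conj.IH(1)) (use Conj.prems in auto)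
  moreover have "eval (subst x t B) I = eval B J" by (rule Conj.IH(2)) (use Conj.prems in auto)
  ultimately show ?case by simp
next
  case (Dis A B)
  have "eval (subst x t A) I = eval A J" by (rule Dis.IH(1)) (use Dis.prems in auto)
  moreover have "eval (subst x t B) I = eval B J" by (rule Dis.IH(2)) (use Dis.prems in auto)
  ultimately show ?case by simp
next
  case (Imp A B)
  have "eval (subst x t A) I = eval A J" by (rule Imp.IH(1)) (use Imp.prems in auto)
  moreover have "eval (subst x t B) I = eval B J" by (rule Imp.IH(2)) (use Imp.prems in auto)
  ultimately show ?case by simp
next
  case (All y A)
  show ?case
  proof (cases "x \<in> free_vars (All y A)")
    case True
    then have y: "y \<noteq> x" "y \<notin> vars_tm t" "free_for t x A" using All.prems(1) by auto
    have "eval (subst x t A) (I\<lparr>VarI := (VarI I)(y := d)\<rparr>) = eval A (J\<lparr>VarI := (VarI J)(y := d)\<rparr>)" for d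
    proof (rule All.IH[OF y(3)])
      have "eval_tm (I\<lparr>VarI := (VarI I)(y := d)\<rparr>) t = eval_tm I t"
        using y(2) by (intro eval_tm_cong) auto
      then show "VarI (J\<lparr>VarI := (VarI J)(y := d)\<rparr>) x = eval_tm (I\<lparr>VarI := (VarI I)(y := d)\<rparr>) t"
        using y(1) All.prems by simp
    qed (use All.prems in auto)
    then show ?thesis using y(1) All.prems by simp
  next
    case False
    have "eval (All y A) I = eval (All y A) J"
    proof (rule eval_cong)
      fix z assume "z \<in> free_vars (All y A)"
      then have "z \<noteq> x" using False by blast
      then show "VarI I z = VarI J z" using All.prems by simp
    qed (use All.prems in auto)
    then show ?thesis by (simp only: subst_fresh[OF False])
  qed
next
  case (Ex y A)
  show ?case
  proof (cases "x \<in> free_vars (Ex y A)")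
    case True
    then have y: "y \<noteq> x" "y \<notin> vars_tm t" "free_for t x A" using Ex.prems(1) by auto
    have "eval (subst x t A) (I\<lparr>VarI := (VarI I)(y := d)\<rparr>) = eval A (J\<lparr>VarI := (VarI J)(y := d)\<rparr>)" for d
    proof (rule Ex.IH[OF y(3)])
      have "eval_tm (I\<lparr>VarI := (VarI I)(y := d)\<rparr>) t = eval_tm I t"
        using y(2) by (intro eval_tm_cong) auto
      then show "VarI (J\<lparr>VarI := (VarI J)(y := d)\<rparr>) x = eval_tm (I\<lparr>VarI := (VarI I)(y := d)\<rparr>) t"
        using y(1) Ex.prems by simp
    qed (use Ex.prems in auto)
    then show ?thesis using y(1) Ex.prems by simp
  next
    case False
    have "eval (Ex y A) I = eval (Ex y A) J"
    proof (rule eval_cong)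
      fix z assume "z \<in> free_vars (Ex y A)"
      then have "z \<noteq> x" using False by blast
      then show "VarI I z = VarI J z" using Ex.prems by simp
    qed (use Ex.prems in auto)
    then show ?thesis by (simp only: subst_fresh[OF False])
  qed
qed simp

lemma eval_subst:
  "free_for t x A \<Longrightarrow> eval (subst x t A) I = eval A (I\<lparr>VarI := (VarI I)(x := eval_tm I t)\<rparr>)"
  by (rule eval_subst_aux) auto

lemma eval_tm_in_Dom:
  "interp_on V I \<Longrightarrow> eval_tm I t \<in> Dom I"
proof (induction t)
  case (Fn f ts)
  then have "map (eval_tm I) ts \<in> lists (Dom I)" by auto
  then show ?case using Fn.prems by (auto simp: interp_on_def)
qed (simp add: interp_on_def)

lemma interp_on_update:
  "interp_on V I \<Longrightarrow> d \<in> Dom I \<Longrightarrow> interp_on V (I\<lparr>VarI := (VarI I)(x := d)\<rparr>)"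
  by (auto simp: interp_on_def)

text \<open>Quantified formulas keep their values in \<open>V\<close> because \<open>V\<close> is
  closed and the values of the instances form a nonempty bounded set.\<close>

lemma eval_in_truth_values:
  assumes "truth_value_set V"
  shows "interp_on V I \<Longrightarrow> eval A I \<in> V"
proof (induction A arbitrary: I)
  case Bot
  then show ?case using assms by (simp add: truth_value_set_def)
next
  case (Pr p ts)
  then have "map (eval_tm I) ts \<in> lists (Dom I)" by (auto intro: eval_tm_in_Dom)
  then show ?case using Pr by (auto simp: interp_on_def)
next
  case (Imp A B)
  then show ?case using assms by (simp add: truth_value_set_def)
next
  case (All x A)
  let ?S = "(\<lambda>d. eval A (I\<lparr>VarI := (VarI I)(x := d)\<rparr>)) ` Dom I"
  have S: "?S \<subseteq> V" using All.IH[OF interp_on_update[OF All.prems]] by auto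
  have "?S \<noteq> {}" using All.prems by (simp add: interp_on_def)
  moreover have "?S \<subseteq> {0..1}" using S assms unfolding truth_value_set_def by (meson subset_trans)
  then have "bdd_below ?S" by (rule bdd_below_mono[OF bdd_below_Icc])
  moreover have "closed V" using assms by (simp add: truth_value_set_def)
  ultimately show ?case using closed_subset_contains_Inf[OF _ S] by simp
next
  case (Ex x A)
  let ?S = "(\<lambda>d. eval A (I\<lparr>VarI := (VarI I)(x := d)\<rparr>)) ` Dom I"
  have S: "?S \<subseteq> V" using Ex.IH[OF interp_on_update[OF Ex.prems]] by auto
  have "?S \<noteq> {}" using Ex.prems by (simp add: interp_on_def)
  moreover have "?S \<subseteq> {0..1}" using S assms unfolding truth_value_set_def by (meson subset_trans)
  then have "bdd_above ?S" by (rule bdd_above_mono[OF bdd_above_Icc])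
  moreover have "closed V" using assms by (simp add: truth_value_set_def)
  ultimately show ?case using closed_subset_contains_Sup[OF _ S] by simp
qed (simp_all add: min_def max_def)

lemma eval_bounds:
  assumes "truth_value_set V" "interp_on V I" shows "0 \<le> eval A I" "eval A I \<le> 1"
  using eval_in_truth_values[OF assms, of A] assms(1) by (auto simp: truth_value_set_def)

lemma eval_le_big_disj: "A \<in> set As \<Longrightarrow> eval A I \<le> eval (big_disj As) I"
  by (induction As rule: big_disj.induct) (auto simp: le_max_iff_disj)

text \<open>Pigeonhole: two of the \<open>card V + 1\<close> formulas share a value, and the
  disjunct for this pair is then 1.\<close>

lemma eval_finite_axiom:
  assumes "truth_value_set V" "interp_on V I" "finite V"
  shows "eval (finite_axiom (card V) A) I = 1"
proof -
  let ?m = "card V"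
  let ?E = "\<lambda>i j. Conj (Imp (A i) (A j)) (Imp (A j) (A i))"
  let ?D = "\<lambda>i. big_disj (map (?E i) [i + 1..<?m + 2])"
  have "(\<lambda>i. eval (A i) I) ` {1..?m + 1} \<subseteq> V" using eval_in_truth_values[OF assms(1,2)] by blast
  then have "\<not> inj_on (\<lambda>i. eval (A i) I) {1..?m + 1}"
    using card_inj_on_le[OF _ _ assms(3), of "\<lambda>i. eval (A i) I" "{1..?m + 1}"] by auto
  then obtain i j where ij: "1 \<le> i" "i < j" "j \<le> ?m + 1" "eval (A i) I = eval (A j) I"
    unfolding inj_on_def by (metis atLeastAtMost_iff linorder_neqE_nat)
  have "1 \<le> eval (?E i j) I" using ij(4) by simp
  also have "\<dots> \<le> eval (?D i) I" by (rule eval_le_big_disj) (use ij in \<open>auto simp del: upt_Suc\<close>)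
  also have "\<dots> \<le> eval (big_disj (map ?D [1..<?m + 1])) I"
    by (rule eval_le_big_disj) (use ij in \<open>auto simp del: upt_Suc\<close>)
  finally have "1 \<le> eval (finite_axiom ?m A) I" by (simp only: finite_axiom_def)
  then show ?thesis using eval_bounds(2)[OF assms(1,2)] by (intro antisym)
qed

text \<open>The interpretation stays arbitrary in the induction, because generalization uses its
  premise under all reassignments of the eigenvariable.\<close>

theorem derivable_sound:
  assumes V: "truth_value_set V"
  shows "derivable (extra_axioms V) A \<Longrightarrow> interp_on V I \<Longrightarrow> eval A I = 1"
proof (induction arbitrary: I rule: derivable.induct)
  case (lc A)
  then show ?case
  proof (cases rule: lc_axiom.cases)
  qed (use eval_bounds[OF V lc.prems] in \<open>auto simp: min_def max_def not_le not_less intro: antisym\<close>)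
next
  case (extra A)
  then obtain B where "finite V" "A = finite_axiom (card V) B"
    by (auto simp: extra_axioms_def split: if_splits)
  then show ?case using eval_finite_axiom[OF V extra.prems] by simp
next
  case (mp A B)
  have "eval (Imp A B) I = 1" "eval A I = 1" using mp by blast+
  then show ?case using eval_bounds(2)[OF V mp.prems, of B] by (auto split: if_splits)
next
  case (all_intro x y A)
  have "eval A (I\<lparr>VarI := (VarI I)(x := d)\<rparr>) = 1" if d: "d \<in> Dom I" for d
  proof -
    \<comment> \<open>The eigenvariable takes the value \<open>d\<close>; not being free in
      \<open>All x A\<close>, it can be reset once \<open>x\<close> has this value.\<close>
    let ?J = "I\<lparr>VarI := (VarI I)(y := d)\<rparr>"
    have "eval (subst x (Var y) A) ?J = 1"
      using all_intro.IH interp_on_update[OF all_intro.prems d] by blast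
    then have "eval A (?J\<lparr>VarI := (VarI ?J)(x := d)\<rparr>) = 1"
      using eval_subst[OF all_intro.hyps(2), of ?J] by simp
    moreover have "eval A (?J\<lparr>VarI := (VarI ?J)(x := d)\<rparr>) = eval A (I\<lparr>VarI := (VarI I)(x := d)\<rparr>)"
      using all_intro.hyps(3) by (intro eval_cong) auto
    ultimately show ?thesis by simp
  qed
  then show ?case using all_intro.prems by (simp add: interp_on_def)
next
  case (ex_intro x t A)
  let ?f = "\<lambda>d. eval A (I\<lparr>VarI := (VarI I)(x := d)\<rparr>)"
  have t: "eval_tm I t \<in> Dom I" using ex_intro.prems by (rule eval_tm_in_Dom)
  have "?f (eval_tm I t) = 1" using ex_intro eval_subst[OF ex_intro.hyps(2)] by metis
  moreover have "?f d \<le> 1" if "d \<in> Dom I" for d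
    using eval_bounds(2)[OF V interp_on_update[OF ex_intro.prems that]] .
  ultimately have "(SUP d\<in>Dom I. ?f d) = 1"
    using t by (intro cSup_eq_maximum) auto
  then show ?case by simp
next
  case (all_shift x A B)
  let ?J = "\<lambda>d. I\<lparr>VarI := (VarI I)(x := d)\<rparr>"
  have ne: "Dom I \<noteq> {}" using all_shift.prems by (simp add: interp_on_def)
  have B: "eval B (?J d) = eval B I" for d using all_shift.hyps(2) by (intro eval_cong) auto
  have "(INF d\<in>Dom I. max (eval A (?J d)) (eval B I)) = 1"
    using all_shift.IH[OF all_shift.prems] by (simp add: B)
  moreover have "bdd_below ((\<lambda>d. max (eval A (?J d)) (eval B I)) ` Dom I)"
    using eval_bounds(1)[OF V all_shift.prems, of B] by (intro bdd_belowI[of _ 0]) auto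
  ultimately have ge: "1 \<le> max (eval A (?J d)) (eval B I)" if "d \<in> Dom I" for d
    using cINF_lower[OF _ that] by metis
  \<comment> \<open>Either \<open>B\<close> has value 1, or every instance of \<open>A\<close> has
    value 1 by itself.\<close>
  have "eval (Dis (All x A) B) I \<ge> 1"
  proof (cases "eval B I \<ge> 1")
    case False
    then have "1 \<le> eval A (?J d)" if "d \<in> Dom I" for d using ge[OF that] by auto
    then have "1 \<le> (INF d\<in>Dom I. eval A (?J d))" using ne by (intro cINF_greatest)
    then show ?thesis by simp
  qed simp
  then show ?case using eval_bounds(2)[OF V all_shift.prems] by (intro antisym)
next
  case (ex_shift x A B)
  let ?J = "\<lambda>d. I\<lparr>VarI := (VarI I)(x := d)\<rparr>"
  have ne: "Dom I \<noteq> {}" using ex_shift.prems by (simp add: interp_on_def)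
  have B: "eval B (?J d) = eval B I" for d using ex_shift.hyps(2) by (intro eval_cong) auto
  have "bdd_above ((\<lambda>d. eval A (?J d)) ` Dom I)"
    using eval_bounds(2)[OF V interp_on_update[OF ex_shift.prems]] by (intro bdd_aboveI[of _ 1]) auto
  note upper = cSUP_upper[OF _ this]
  have "max (eval A (?J d)) (eval B I) \<le> eval (Dis (Ex x A) B) I" if "d \<in> Dom I" for d
    using upper[OF that] by auto
  then have "(SUP d\<in>Dom I. max (eval A (?J d)) (eval B I)) \<le> eval (Dis (Ex x A) B) I"
    using ne by (intro cSUP_least)
  then have "1 \<le> eval (Dis (Ex x A) B) I"
    using ex_shift.IH[OF ex_shift.prems] by (simp add: B)
  then show ?case using eval_bounds(2)[OF V ex_shift.prems] by (intro antisym)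
qed

section \<open>Prime theories\<close>

text \<open>Hypotheses are closed under modus ponens only; the quantifier rules act solely inside
  \<open>derivable\<close>. Hence the deduction theorem needs no eigenvariable condition.\<close>

inductive entails :: "fm set \<Rightarrow> fm set \<Rightarrow> fm \<Rightarrow> bool" for X S :: "fm set" where
  logic: "derivable X A \<Longrightarrow> entails X S A"
| hyp: "A \<in> S \<Longrightarrow> entails X S A"
| mp: "entails X S (Imp A B) \<Longrightarrow> entails X S A \<Longrightarrow> entails X S B"

lemma entails_empty: "entails X {} A \<longleftrightarrow> derivable X A"
proof
  show "entails X {} A \<Longrightarrow> derivable X A"
  proof (induction rule: entails.induct)
    case (mp A B)
    then show ?case by (intro derivable.mp[of X A B])
  qed auto
qed (rule entails.logic)

lemma entails_mono: "entails X S A \<Longrightarrow> S \<subseteq> S' \<Longrightarrow> entails X S' A"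
proof (induction rule: entails.induct)
  case (mp A B)
  then show ?case by (intro entails.mp[of X S' A B])
qed (auto intro: entails.logic entails.hyp)

lemma entails_weaken: "entails X S A \<Longrightarrow> entails X S (Imp B A)"
  by (rule entails.mp[OF entails.logic[OF lc_derivable(1)]])

lemma entails_deduction:
  assumes "entails X (insert A S) B" shows "entails X S (Imp A B)"
proof -
  have refl: "entails X S (Imp A A)"
    using entails.mp[OF entails.mp[OF entails.logic[OF lc_derivable(2)[of X A "Imp A A" A]]
        entails.logic[OF lc_derivable(1)]] entails.logic[OF lc_derivable(1)]] .
  show ?thesis
    using assms
  proof (induction rule: entails.induct)
    case (logic B)
    then show ?case by (intro entails_weaken entails.logic)
  next
    case (hyp B)
    then show ?case using refl by (auto intro: entails_weaken entails.hyp)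
  next
    case (mp B C)
    show ?case using mp.IH by (rule entails.mp[OF entails.mp[OF entails.logic[OF lc_derivable(2)]]])
  qed
qed

lemma entails_cut: "entails X S A \<Longrightarrow> entails X (insert A S) B \<Longrightarrow> entails X S B"
  by (rule entails.mp[OF entails_deduction])

lemma entails_disI1: "entails X S A \<Longrightarrow> entails X S (Dis A B)"
  by (rule entails.mp[OF entails.logic[OF lc_derivable(6)]])

lemma entails_disI2: "entails X S B \<Longrightarrow> entails X S (Dis A B)"
  by (rule entails.mp[OF entails.logic[OF lc_derivable(7)]])

lemma entails_disE:
  "entails X S (Dis A B) \<Longrightarrow> entails X (insert A S) C \<Longrightarrow> entails X (insert B S) C \<Longrightarrow> entails X S C"
  by (rule entails.mp[OF entails.mp[OF entails.mp[OF entails.logic[OF lc_derivable(8)]]]])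
    (auto intro: entails_deduction)

lemma entails_botE: "entails X S Bot \<Longrightarrow> entails X S A"
  by (rule entails.mp[OF entails.logic[OF lc_derivable(9)]])

abbreviation disjunction :: "fm list \<Rightarrow> fm" where
  "disjunction As \<equiv> foldr Dis As Bot"

lemma entails_disjunctionI: "A \<in> set As \<Longrightarrow> entails X S A \<Longrightarrow> entails X S (disjunction As)"
  by (induction As) (auto intro: entails_disI1 entails_disI2)

lemma entails_disjunctionE:
  "entails X S (disjunction As) \<Longrightarrow> (\<And>A. A \<in> set As \<Longrightarrow> entails X (insert A S) B) \<Longrightarrow>
    entails X S B"
proof (induction As arbitrary: S)
  case Nil
  then show ?case by (auto intro: entails_botE)
next
  case (Cons A As)
  have "entails X (insert (disjunction As) S) B"
    by (rule Cons.IH) (auto intro: entails.hyp intro!: entails_mono[OF Cons.prems(2)])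
  then show ?case using Cons.prems by (auto intro: entails_disE)
qed

lemma entails_disjunction_mono:
  "entails X S (disjunction As) \<Longrightarrow> set As \<subseteq> set Bs \<Longrightarrow> entails X S (disjunction Bs)"
  by (erule entails_disjunctionE, rule entails_disjunctionI[OF _ entails.hyp]) auto

text \<open>Derivations are finite: a modus ponens step involves two members of the chain, and the
  larger one entails both premises.\<close>

lemma entails_chain:
  assumes "subset.chain \<A> \<C>" "\<C> \<noteq> {}"
  shows "entails X (\<Union>\<C>) A \<Longrightarrow> \<exists>S\<in>\<C>. entails X S A"
proof (induction rule: entails.induct)
  case (logic A)
  then show ?case using assms(2) by (auto intro: entails.logic)
next
  case (hyp A)
  then show ?case by (auto intro: entails.hyp)
next
  case (mp A B)
  then obtain S S' where S: "S \<in> \<C>" "entails X S (Imp A B)" "S' \<in> \<C>" "entails X S' A" by blast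
  then consider "S \<subseteq> S'" | "S' \<subseteq> S" using assms(1) unfolding subset.chain_def by blast
  then show ?case
  proof cases
    case 1
    then show ?thesis using S entails.mp[OF entails_mono[OF S(2)] S(4)] by blast
  next
    case 2
    then show ?thesis using S entails.mp[OF S(2) entails_mono[OF S(4)]] by blast
  qed
qed

locale prime_theory =
  fixes X T :: "fm set"
  assumes entails_closed: "entails X T A \<Longrightarrow> A \<in> T"
    and prime: "Dis A B \<in> T \<Longrightarrow> A \<in> T \<or> B \<in> T"
    and consistent: "Bot \<notin> T"

text \<open>Zorn's lemma gives a maximal set entailing no finite disjunction from \<open>D\<close>.
  Maximality makes it closed and prime.\<close>

lemma prime_theory_avoiding:
  assumes "\<And>As. set As \<subseteq> D \<Longrightarrow> \<not> derivable X (disjunction As)"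
  obtains T where "prime_theory X T" "D \<inter> T = {}"
proof -
  define \<A> where "\<A> = {S. \<forall>As. set As \<subseteq> D \<longrightarrow> \<not> entails X S (disjunction As)}"
  have "{} \<in> \<A>" unfolding \<A>_def using assms entails_empty by blast
  moreover have "\<Union>\<C> \<in> \<A>" if "\<C> \<noteq> {}" "subset.chain \<A> \<C>" for \<C>
  proof -
    have "\<C> \<subseteq> \<A>" using that(2) by (simp add: subset.chain_def)
    then show ?thesis using entails_chain[OF that(2,1), of X] unfolding \<A>_def by blast
  qed
  ultimately obtain T where T: "T \<in> \<A>" "\<And>S. S \<in> \<A> \<Longrightarrow> T \<subseteq> S \<Longrightarrow> S = T"
    using subset_Zorn_nonempty[of \<A>] by blast
  have ext: "\<exists>As. set As \<subseteq> D \<and> entails X (insert A T) (disjunction As)" if "A \<notin> T" for A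
    using T(2)[of "insert A T"] that unfolding \<A>_def by blast
  have avoid: "\<not> entails X T (disjunction As)" if "set As \<subseteq> D" for As
    using T(1) that unfolding \<A>_def by blast
  have "prime_theory X T"
  proof
    fix A assume "entails X T A"
    then show "A \<in> T" using ext avoid entails_cut by blast
  next
    fix A B assume AB: "Dis A B \<in> T"
    show "A \<in> T \<or> B \<in> T"
    proof (rule ccontr)
      assume "\<not> (A \<in> T \<or> B \<in> T)"
      then obtain As Bs where As: "set As \<subseteq> D" "entails X (insert A T) (disjunction As)"
        and Bs: "set Bs \<subseteq> D" "entails X (insert B T) (disjunction Bs)"
        using ext by blast
      \<comment> \<open>Each disjunct entails its own disjunction from \<open>D\<close>; joining the
        two lists contradicts the choice of \<open>T\<close>.\<close>
      have "entails X T (disjunction (As @ Bs))"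
        by (rule entails_disE[OF entails.hyp[OF AB]])
          (rule entails_disjunction_mono[OF As(2)] entails_disjunction_mono[OF Bs(2)]; simp)+
      then show False using avoid As(1) Bs(1) by (metis Un_least set_append)
    qed
  next
    \<comment> \<open>\<open>Bot\<close> is the empty disjunction.\<close>
    show "Bot \<notin> T" using avoid[of "[]"] by (auto intro: entails.hyp)
  qed
  moreover have "D \<inter> T = {}"
  proof (rule equals0I)
    fix A assume "A \<in> D \<inter> T"
    then show False using avoid[of "[A]"] by (auto intro: entails_disI1 entails.hyp)
  qed
  ultimately show ?thesis by (rule that)
qed

section \<open>The linear preorder of a prime theory\<close>

context prime_theory
begin

lemma derivable_in: "derivable X A \<Longrightarrow> A \<in> T"
  by (rule entails_closed) (rule entails.logic)

lemma mp_in: "Imp A B \<in> T \<Longrightarrow> A \<in> T \<Longrightarrow> B \<in> T"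
  by (rule entails_closed) (rule entails.mp[OF entails.hyp entails.hyp])

lemma imp_iff_insert: "Imp A B \<in> T \<longleftrightarrow> entails X (insert A T) B"
proof
  assume "Imp A B \<in> T"
  then show "entails X (insert A T) B"
    by (intro entails.mp[OF entails.hyp entails.hyp]) auto
qed (intro entails_closed entails_deduction)

definition le :: "fm \<Rightarrow> fm \<Rightarrow> bool" where "le A B \<longleftrightarrow> Imp A B \<in> T"

lemma le_refl: "le A A"
  by (auto simp: le_def imp_iff_insert intro: entails.hyp)

lemma le_trans: "le A B \<Longrightarrow> le B C \<Longrightarrow> le A C"
  unfolding le_def imp_iff_insert
  by (rule entails_cut[of _ _ B]) (auto elim!: entails_mono)

lemma le_total: "le A B \<or> le B A"
  unfolding le_def using derivable_in[OF lc_derivable(10)] prime by blast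

lemma le_bot: "le Bot A"
  unfolding le_def by (rule derivable_in[OF lc_derivable(9)])

lemma le_top: "B \<in> T \<Longrightarrow> le A B"
  unfolding le_def by (rule entails_closed) (auto intro: entails_weaken entails.hyp)

lemma top_le: "A \<in> T \<Longrightarrow> le A B \<longleftrightarrow> B \<in> T"
  using mp_in le_top unfolding le_def by blast

lemma le_conj: "le (Conj A B) A" "le (Conj A B) B" "le C A \<Longrightarrow> le C B \<Longrightarrow> le C (Conj A B)"
proof -
  show "le (Conj A B) A" "le (Conj A B) B"
    unfolding le_def by (rule derivable_in, rule lc_derivable)+
  show "le C (Conj A B)" if "le C A" "le C B"
    using that unfolding le_def imp_iff_insert
    by (rule entails.mp[OF entails.mp[OF entails.logic[OF lc_derivable(5)]]])
qed

lemma le_dis: "le A (Dis A B)" "le B (Dis A B)" "le A C \<Longrightarrow> le B C \<Longrightarrow> le (Dis A B) C"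
proof -
  show "le A (Dis A B)" "le B (Dis A B)"
    unfolding le_def by (rule derivable_in, rule lc_derivable)+
  show "le (Dis A B) C" if "le A C" "le B C"
    using that mp_in derivable_in[OF lc_derivable(8)] unfolding le_def by blast
qed

text \<open>
  If \<open>A \<rightarrow> (A \<rightarrow> B)\<close> is not in the theory, then \<open>(A \<rightarrow> B) \<rightarrow> A\<close> is, by linearity; hence
  \<open>A \<rightarrow> B\<close> is equivalent to \<open>B\<close>.
\<close>

lemma le_imp:
  assumes "\<not> le A B" shows "le (Imp A B) B" "le B (Imp A B)"
proof -
  have "\<not> le A (Imp A B)"
  proof
    assume "le A (Imp A B)"
    then have "entails X (insert A T) (Imp A B)" by (simp add: le_def imp_iff_insert)
    then have "entails X (insert A T) B" by (rule entails.mp) (simp add: entails.hyp)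
    then show False using assms by (simp add: le_def imp_iff_insert)
  qed
  then have "le (Imp A B) A" using le_total by blast
  then have "entails X (insert (Imp A B) T) A" by (simp add: le_def imp_iff_insert)
  then have "entails X (insert (Imp A B) T) B"
    by (rule entails.mp[rotated]) (simp add: entails.hyp)
  then show "le (Imp A B) B" by (simp add: le_def imp_iff_insert)
  show "le B (Imp A B)" unfolding le_def by (rule derivable_in[OF lc_derivable(1)])
qed

text \<open>A map representing the preorder turns equivalence modulo \<open>T\<close> into equality,
  so by linearity each connective reduces to a comparison of two values.\<close>

lemma valuation_connectives:
  fixes v :: "fm \<Rightarrow> real"
  assumes v: "\<And>A B. v A \<le> v B \<longleftrightarrow> le A B" and top: "\<And>A. v A = 1 \<longleftrightarrow> A \<in> T"
  shows "v (Conj A B) = min (v A) (v B)"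
    and "v (Dis A B) = max (v A) (v B)"
    and "v (Imp A B) = (if v A > v B then v B else 1)"
proof -
  have eq: "v A = v B \<longleftrightarrow> le A B \<and> le B A" for A B using v by (metis antisym order_refl)
  show "v (Conj A B) = min (v A) (v B)"
  proof (cases "le A B")
    case True
    then have "v (Conj A B) = v A" using le_conj(1) le_conj(3)[OF le_refl True] by (simp add: eq)
    then show ?thesis using True by (simp add: min_def v)
  next
    case False
    then have BA: "le B A" using le_total by blast
    have "v (Conj A B) = v B" using le_conj(2) le_conj(3)[OF BA le_refl] by (simp add: eq)
    then show ?thesis using False by (simp add: min_def v)
  qed
  show "v (Dis A B) = max (v A) (v B)"
  proof (cases "le A B")
    case True
    then have "v (Dis A B) = v B" using le_dis(2) le_dis(3)[OF True le_refl] by (simp add: eq)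
    then show ?thesis using True by (simp add: max_def v)
  next
    case False
    then have BA: "le B A" using le_total by blast
    have "v (Dis A B) = v A" using le_dis(1) le_dis(3)[OF le_refl BA] by (simp add: eq)
    then show ?thesis using False by (simp add: max_def v)
  qed
  show "v (Imp A B) = (if v A > v B then v B else 1)"
    using le_imp[of A B] by (auto simp: not_le[symmetric] v eq top le_def)
qed

end

section \<open>Embedding prime theories into truth value sets\<close>

text \<open>Unlike \<open><\<close>, this relation is dense on every \<open>V\<close>.\<close>

definition far_below :: "real set \<Rightarrow> real \<Rightarrow> real \<Rightarrow> bool" where
  "far_below V a b \<longleftrightarrow> uncountable (V \<inter> {a<..<b})"

lemma far_below_less: "far_below V a b \<Longrightarrow> a < b"
  unfolding far_below_def by (rule ccontr) simp

lemma far_below_mono: "far_below V a b \<Longrightarrow> a' \<le> a \<Longrightarrow> b \<le> b' \<Longrightarrow> far_below V a' b'"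
  unfolding far_below_def by (erule contrapos_nn) (erule countable_subset[rotated]; auto)

section \<open>Dense chains in uncountable sets of reals\<close>

lemma countable_union_rational_cuts:
  fixes P :: "real \<Rightarrow> real set"
  shows "countable (\<Union>q\<in>{q \<in> \<rat>. countable (P q)}. P q)"
  by (rule countable_UN) (auto intro: countable_subset[OF _ countable_rat])

lemma countable_at_most_one:
  assumes "\<And>x y. x \<in> S \<Longrightarrow> y \<in> S \<Longrightarrow> x = y" shows "countable S"
proof (cases "S = {}")
  case False
  then obtain x where "x \<in> S" by blast
  then have "S = {x}" using assms by blast
  then show ?thesis by simp
qed simp

text \<open>\<open>U\<close> collects the countable segments ending at rationals. Of two exceptional
  points outside \<open>U\<close>, the smaller would lie in such a segment, cut off by a rational
  between them; hence there is at most one.\<close>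

lemma countable_not_far_above: "countable {w \<in> V. a < w \<and> \<not> far_below V a w}"
proof -
  define U where "U = (\<Union>q\<in>{q \<in> \<rat>. countable (V \<inter> {a<..<q})}. V \<inter> {a<..<q})"
  let ?S = "{w \<in> V. a < w \<and> \<not> far_below V a w}"
  have less: False if "w \<in> ?S - U" "w' \<in> ?S - U" "w < w'" for w w'
  proof -
    note less = that
    obtain q where q: "q \<in> \<rat>" "w < q" "q < w'" using Rats_dense_in_real[OF less(3)] by blast
    have "countable (V \<inter> {a<..<w'})" using that(2) by (simp add: far_below_def)
    then have "countable (V \<inter> {a<..<q})" by (rule countable_subset[rotated]) (use q in auto)
    then have "w \<in> U" using that(1) q unfolding U_def by auto
    then show False using that(1) by blast
  qed
  have "countable (?S - U)"
  proof (rule countable_at_most_one)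
    fix x y assume "x \<in> ?S - U" "y \<in> ?S - U"
    then show "x = y" using less[of x y] less[of y x] by (cases x y rule: linorder_cases) blast+
  qed
  moreover have "countable U" unfolding U_def by (rule countable_union_rational_cuts)
  ultimately have "countable ((?S - U) \<union> U)" by (rule countable_Un)
  then show ?thesis by (rule countable_subset[rotated]) blast
qed

text \<open>The mirror image, with segments beginning at rationals.\<close>

lemma countable_not_far_below: "countable {w \<in> V. w < b \<and> \<not> far_below V w b}"
proof -
  define U where "U = (\<Union>q\<in>{q \<in> \<rat>. countable (V \<inter> {q<..<b})}. V \<inter> {q<..<b})"
  let ?S = "{w \<in> V. w < b \<and> \<not> far_below V w b}"
  have less: False if "w \<in> ?S - U" "w' \<in> ?S - U" "w < w'" for w w'
  proof -
    note less = that
    obtain q where q: "q \<in> \<rat>" "w < q" "q < w'" using Rats_dense_in_real[OF less(3)] by blast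
    have "countable (V \<inter> {w<..<b})" using that(1) by (simp add: far_below_def)
    then have "countable (V \<inter> {q<..<b})" by (rule countable_subset[rotated]) (use q in auto)
    then have "w' \<in> U" using that(2) q unfolding U_def by auto
    then show False using that(2) by blast
  qed
  have "countable (?S - U)"
  proof (rule countable_at_most_one)
    fix x y assume "x \<in> ?S - U" "y \<in> ?S - U"
    then show "x = y" using less[of x y] less[of y x] by (cases x y rule: linorder_cases) blast+
  qed
  moreover have "countable U" unfolding U_def by (rule countable_union_rational_cuts)
  ultimately have "countable ((?S - U) \<union> U)" by (rule countable_Un)
  then show ?thesis by (rule countable_subset[rotated]) blast
qed

text \<open>The two exceptional sets are countable and cannot exhaust the uncountable
  segment.\<close>

lemma far_below_dense:
  assumes "far_below V a b"
  obtains w where "w \<in> V" "far_below V a w" "far_below V w b"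
proof -
  have "\<not> V \<inter> {a<..<b} \<subseteq> {w \<in> V. a < w \<and> \<not> far_below V a w} \<union> {w \<in> V. w < b \<and> \<not> far_below V w b}"
    using assms countable_Un[OF countable_not_far_above countable_not_far_below]
    unfolding far_below_def by (metis (no_types) countable_subset)
  then show ?thesis using that by auto
qed

text \<open>A Cantor-style construction, one index at a time. Requiring \<open>far_below\<close>
  instead of \<open><\<close> between inequivalent values leaves room for every later index.\<close>

lemma uncountable_order_embedding:
  fixes V :: "real set" and R :: "nat \<Rightarrow> nat \<Rightarrow> bool"
  assumes ab: "far_below V a b"
    and trans: "\<And>k m n. R k m \<Longrightarrow> R m n \<Longrightarrow> R k n" and total: "\<And>m n. R m n \<or> R n m"
  obtains f where "\<And>n. f n \<in> V \<inter> {a<..<b}" "\<And>m n. f m \<le> f n \<longleftrightarrow> R m n"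
proof -
  let ?L = "far_below V"
  define P where "P f n r \<longleftrightarrow> r \<in> V \<and> ?L a r \<and> ?L r b \<and>
    (\<forall>m<n. (R m n \<and> R n m \<longrightarrow> r = f m) \<and> (\<not> R n m \<longrightarrow> ?L (f m) r) \<and> (\<not> R m n \<longrightarrow> ?L r (f m)))"
    for f :: "nat \<Rightarrow> real" and n r
  have "\<exists>f. \<forall>n. P f n (f n)"
  proof (rule dependent_wf_choice[OF wf_less])
    show "P f n r = P g n r" if "\<And>z. (z, n) \<in> {(x, y). x < y} \<Longrightarrow> f z = g z" for f g n r
      using that by (auto simp: P_def)
    show "\<exists>r. P f n r" if "\<And>y. (y, n) \<in> {(x, y). x < y} \<Longrightarrow> P f y (f y)" for n f
    proof -
      have IH: "P f m (f m)" if "m < n" for m using that \<open>\<And>y. _ \<Longrightarrow> P f y (f y)\<close> by simp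
      have strict: "?L (f k) (f m)" if "k < n" "m < n" "\<not> R m k" for k m
        using IH[OF that(1)] IH[OF that(2)] that(3) total[of m m]
        by (cases k m rule: linorder_cases) (auto simp: P_def)
      have equal: "f k = f m" if "k < n" "m < n" "R m k" "R k m" for k m
        using IH[OF that(1)] IH[OF that(2)] that(3,4)
        by (cases k m rule: linorder_cases) (auto simp: P_def)
      show ?thesis
      proof (cases "\<exists>m<n. R m n \<and> R n m")
        case True
        then obtain m where m: "m < n" "R m n" "R n m" by blast
        have "R n k \<longleftrightarrow> R m k" "R k n \<longleftrightarrow> R k m" for k using m trans by blast+
        then have "P f n (f m)"
          \<comment> \<open>An index equivalent to an earlier one inherits its value.\<close>
          using IH[OF m(1)] strict[OF m(1)] strict[OF _ m(1)] equal[OF m(1)]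
          by (simp add: P_def)
        then show ?thesis by blast
      next
        case False
        \<comment> \<open>The bounds \<open>a\<close> and \<open>b\<close> keep both finite sets
          nonempty. As no earlier index is equivalent to \<open>n\<close>, every element of the
          first is far below every element of the second.\<close>
        let ?A = "insert a (f ` {m. m < n \<and> R m n})" and ?B = "insert b (f ` {m. m < n \<and> R n m})"
        have "?L l u" if "l \<in> ?A" "u \<in> ?B" for l u
        proof -
          have "?L (f k) (f m)" if "k < n" "R k n" "m < n" "R n m" for k m
            using strict[OF that(1,3)] that False trans by blast
          moreover have "?L a (f k)" "?L (f k) b" if "k < n" for k
            using IH[OF that] by (auto simp: P_def)
          ultimately show ?thesis using that ab by auto
        qed
        moreover have "Max ?A \<in> ?A" "Min ?B \<in> ?B" by (rule Max_in Min_in; simp)+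
        ultimately have "?L (Max ?A) (Min ?B)" by blast
        then obtain w where w: "w \<in> V" "?L (Max ?A) w" "?L w (Min ?B)" by (rule far_below_dense)
        have A: "?L l w" if "l \<in> ?A" for l
          using far_below_mono[OF w(2) Max_ge[OF _ that]] by simp
        have B: "?L w u" if "u \<in> ?B" for u
          using far_below_mono[OF w(3) _ Min_le[OF _ that]] by simp
        have "P f n w"
          unfolding P_def
        proof (intro conjI allI impI)
          fix m assume m: "m < n"
          show "w = f m" if "R m n \<and> R n m" using False m that by blast
          show "?L (f m) w" if "\<not> R n m" using A[of "f m"] m that total[of m n] by blast
          show "?L w (f m)" if "\<not> R m n" using B[of "f m"] m that total[of m n] by blast
        qed (use w(1) A[of a] B[of b] in simp_all)
        then show ?thesis by blast
      qed
    qed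
  qed
  then obtain f where f: "\<And>n. P f n (f n)" by blast
  have strict: "f k < f m" if "\<not> R m k" for k m
    using f[of k] f[of m] that total[of m m] far_below_less[of V "f k" "f m"]
    by (cases k m rule: linorder_cases) (auto simp: P_def)
  have equal: "f k = f m" if "R m k" "R k m" for k m
    using f[of k] f[of m] that by (cases k m rule: linorder_cases) (auto simp: P_def)
  show ?thesis
  proof
    show "f n \<in> V \<inter> {a<..<b}" for n using f[of n] far_below_less[of V] by (auto simp: P_def)
    show "f m \<le> f n \<longleftrightarrow> R m n" for m n
      using strict[of m n] strict[of n m] equal[of m n] total[of m n] by fastforce
  qed
qed

text \<open>If all segments from 0 to \<open>1 - 1/(n+1)\<close> were countable, their union with
  the endpoints would make \<open>V\<close> countable.\<close>

lemma uncountable_far_below: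
  assumes "V \<subseteq> {0..1::real}" "uncountable V"
  obtains c where "c < 1" "far_below V 0 c"
proof -
  have "\<exists>n. far_below V 0 (1 - 1 / real (Suc n))"
  proof (rule ccontr)
    assume "\<nexists>n. far_below V 0 (1 - 1 / real (Suc n))"
    then have "countable (insert 0 (insert 1 (\<Union>n. V \<inter> {0<..<1 - 1 / real (Suc n)})))"
      by (intro countable_insert countable_UN) (auto simp: far_below_def)
    moreover have "V \<subseteq> insert 0 (insert 1 (\<Union>n. V \<inter> {0<..<1 - 1 / real (Suc n)}))"
    proof
      fix x assume x: "x \<in> V"
      show "x \<in> insert 0 (insert 1 (\<Union>n. V \<inter> {0<..<1 - 1 / real (Suc n)}))"
      proof (cases "0 < x \<and> x < 1")
        case True
        then obtain n where "inverse (real (Suc n)) < 1 - x" using reals_Archimedean[of "1 - x"] by (auto simp del: of_nat_Suc)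
        then have "x < 1 - 1 / real (Suc n)" by (simp add: inverse_eq_divide)
        then show ?thesis using x True by (intro insertI2 UN_I[of n]) auto
      qed (use x assms(1) in auto)
    qed
    ultimately show False using assms(2) countable_subset by blast
  qed
  then obtain n where "far_below V 0 (1 - 1 / real (Suc n))" by blast
  then show ?thesis by (rule that[rotated]) simp
qed

section \<open>Valuations in uncountable and in finite truth value sets\<close>

context prime_theory
begin

text \<open>Members of \<open>T\<close> go to 1, formulas equivalent to \<open>Bot\<close> to 0, and
  all others into the interval below \<open>c\<close> by the order embedding, indexed by their
  codes.\<close>

lemma uncountable_valuation:
  assumes "V \<subseteq> {0..1::real}" "uncountable V" "0 \<in> V" "1 \<in> V"
  shows "\<exists>v c. (\<forall>A. v A \<in> V) \<and> (\<forall>A B. v A \<le> v B \<longleftrightarrow> le A B) \<and> v Bot = 0 \<and>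
    (\<forall>A. v A = 1 \<longleftrightarrow> A \<in> T) \<and> c < 1 \<and> (\<forall>A. A \<notin> T \<longrightarrow> v A \<le> c)"
proof -
  obtain c where c: "c < 1" "far_below V 0 c" using uncountable_far_below assms(1,2) by blast
  \<comment> \<open>Numbers that code no formula are also sent to some formula, so the preorder
    pulled back along \<open>dec\<close> is total on all of \<open>nat\<close>.\<close>
  define dec where "dec = inv code_fm"
  have dec: "dec (code_fm A) = A" for A
    unfolding dec_def by (rule inv_f_f) (auto intro: injI code_fm_inject)
  obtain f where f: "\<And>n. f n \<in> V \<inter> {0<..<c}" "\<And>m n. f m \<le> f n \<longleftrightarrow> le (dec m) (dec n)"
    by (rule uncountable_order_embedding[OF c(2), of "\<lambda>m n. le (dec m) (dec n)"])
      (erule (1) le_trans, rule le_total, blast)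
  define v where "v A = (if A \<in> T then 1 else if le A Bot then 0 else f (code_fm A))" for A
  have f1: "0 < f n" "f n < 1" "f n \<le> c" "f n \<in> V" for n using f(1)[of n] c(1) by auto
  have c0: "0 < c" using far_below_less[OF c(2)] .
  have "v A \<le> v B \<longleftrightarrow> le A B" for A B
  proof -
    consider "B \<in> T" | "A \<in> T" "B \<notin> T" | "A \<notin> T" "B \<notin> T" "le A Bot"
      | "A \<notin> T" "B \<notin> T" "\<not> le A Bot" "le B Bot" | "A \<notin> T" "B \<notin> T" "\<not> le A Bot" "\<not> le B Bot"
      by blast
    then show ?thesis
    proof cases
      case 1
      then show ?thesis using le_top f1 by (auto simp: v_def less_imp_le)
    next
      case 2
      then show ?thesis using top_le f1 by (auto simp: v_def not_le)
    next
      case 3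
      then have "le A B" using le_trans le_bot by blast
      then show ?thesis using 3 f1 by (auto simp: v_def less_imp_le)
    next
      case 4
      then have "\<not> le A B" using le_trans by blast
      then show ?thesis using 4 f1 by (auto simp: v_def not_le)
    next
      case 5
      then show ?thesis using f(2)[of "code_fm A" "code_fm B"] by (simp add: v_def dec)
    qed
  qed
  moreover have "v Bot = 0" using consistent le_refl by (simp add: v_def)
  moreover have "v A \<in> V" "v A = 1 \<longleftrightarrow> A \<in> T" "A \<notin> T \<Longrightarrow> v A \<le> c" for A
    using f1[of "code_fm A"] assms c0 by (auto simp: v_def)
  ultimately show ?thesis using c(1) by blast
qed

definition eq_class :: "fm \<Rightarrow> fm set" where "eq_class A = {B. le A B \<and> le B A}"

lemma eq_class_iff: "eq_class A = eq_class B \<longleftrightarrow> le A B \<and> le B A"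
proof
  assume "eq_class A = eq_class B"
  moreover have "A \<in> eq_class A" using le_refl by (simp add: eq_class_def)
  ultimately show "le A B \<and> le B A" by (simp add: eq_class_def)
next
  assume "le A B \<and> le B A"
  then show "eq_class A = eq_class B"
    using le_trans[of A B] le_trans[of B A] le_trans[of _ A B] le_trans[of _ B A]
    unfolding eq_class_def by blast
qed

lemma big_disj_prime: "big_disj As \<in> T \<Longrightarrow> \<exists>A\<in>set As. A \<in> T"
  by (induction As rule: big_disj.induct) (auto simp: consistent dest: prime)

text \<open>Representatives of \<open>m + 1\<close> distinct classes, put into the schema, would by
  primeness contain two equivalent ones. Excluding sets of \<open>m + 1\<close> classes settles
  finiteness and the bound together.\<close>

lemma finite_classes:
  assumes fin: "\<And>A. finite_axiom m A \<in> T"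
  shows "finite (range eq_class)" "card (range eq_class) \<le> m"
proof -
  have no: False if "F \<subseteq> range eq_class" "finite F" "card F = m + 1" for F
  proof -
    note F = that
    obtain h where h: "bij_betw h {1..m + 1} F"
      using ex_bij_betw_nat_finite_1[OF F(2)] F(3) by auto
    then have "\<forall>i\<in>{1..m + 1}. \<exists>A. h i = eq_class A" using that(1) bij_betwE by blast
    then obtain A where A: "\<And>i. i \<in> {1..m + 1} \<Longrightarrow> h i = eq_class (A i)" by metis
    obtain i where i: "1 \<le> i" "i < m + 1" "big_disj (map (\<lambda>j. Conj (Imp (A i) (A j)) (Imp (A j) (A i)))
        [i + 1..<m + 2]) \<in> T"
      using big_disj_prime[OF fin[of A, unfolded finite_axiom_def]] by (auto simp del: upt_Suc)
    then obtain j where j: "i < j" "j < m + 2" "Conj (Imp (A i) (A j)) (Imp (A j) (A i)) \<in> T"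
    proof -
      obtain C where "C \<in> set (map (\<lambda>j. Conj (Imp (A i) (A j)) (Imp (A j) (A i))) [i + 1..<m + 2])" "C \<in> T"
        using big_disj_prime[OF i(3)] by blast
      then show ?thesis using that by (auto simp: Suc_le_eq simp del: upt_Suc)
    qed
    have "le (A i) (A j)" "le (A j) (A i)"
      using mp_in[OF le_conj(1)[unfolded le_def] j(3)] mp_in[OF le_conj(2)[unfolded le_def] j(3)]
      by (simp_all add: le_def)
    then have "h i = h j" using A[of i] A[of j] i j eq_class_iff by auto
    then have "i = j" using inj_onD[OF bij_betw_imp_inj_on[OF h], of i j] i j by auto
    then show False using j(1) by simp
  qed
  show fin': "finite (range eq_class)"
  proof (rule ccontr)
    assume "infinite (range eq_class)"
    then obtain F where "finite F" "card F = m + 1" "F \<subseteq> range eq_class"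
      using infinite_arbitrarily_large by blast
    then show False using no by blast
  qed
  show "card (range eq_class) \<le> m"
  proof (rule ccontr)
    assume "\<not> card (range eq_class) \<le> m"
    then have "m + 1 \<le> card (range eq_class)" by simp
    then obtain F where "F \<subseteq> range eq_class" "card F = m + 1" "finite F"
      by (rule obtain_subset_with_card_n)
    then show False using no by blast
  qed
qed

text \<open>Outside \<open>T\<close>, a formula is sent to the element of \<open>V\<close> whose
  position is the number of classes strictly below it; \<open>T\<close> goes to 1.\<close>

lemma finite_valuation:
  assumes V: "V \<subseteq> {0..1::real}" "finite V" "0 \<in> V" "1 \<in> V"
    and axioms: "\<And>A. finite_axiom (card V) A \<in> T"
  shows "\<exists>v c. (\<forall>A. v A \<in> V) \<and> (\<forall>A B. v A \<le> v B \<longleftrightarrow> le A B) \<and> v Bot = 0 \<and>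
    (\<forall>A. v A = 1 \<longleftrightarrow> A \<in> T) \<and> c < 1 \<and> (\<forall>A. A \<notin> T \<longrightarrow> v A \<le> c)"
proof -
  let ?m = "card V"
  note fin = finite_classes[OF axioms]
  define L where "L = sorted_list_of_set V"
  have L: "length L = ?m" "set L = V" "sorted_wrt (<) L"
    using V(2) by (simp_all add: L_def)
  have Lmono: "L ! i < L ! j \<longleftrightarrow> i < j" if "i < ?m" "j < ?m" for i j
    using that L(1,3) by (metis not_less_iff_gr_or_eq order_less_asym sorted_wrt_nth_less)
  have LV: "L ! i \<in> V" if "i < ?m" for i using that L(1,2) by auto
  have "{0, 1} \<subseteq> V" using V by simp
  then have m2: "2 \<le> ?m" using card_mono[OF V(2), of "{0, 1}"] by simp
  have L0: "L ! 0 = 0"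
  proof -
    obtain k where k: "k < ?m" "L ! k = 0" using V(3) L by (metis in_set_conv_nth)
    have "\<not> 0 < k" using Lmono[of 0 k] k LV[of 0] V(1) m2 by fastforce
    then show ?thesis using k by simp
  qed
  \<comment> \<open>By totality, \<open>\<not> le A B\<close> says that \<open>B\<close> is strictly
    below \<open>A\<close>.\<close>
  define below where "below A = eq_class ` {B. \<not> le A B}" for A
  define rank where "rank A = card (below A)" for A
  have fin_below: "finite (below A)" for A
    using fin(1) finite_subset[of "below A" "range eq_class"] unfolding below_def by blast
  have below_iff: "eq_class B \<in> below A \<longleftrightarrow> \<not> le A B" for A B
    unfolding below_def by (auto simp: eq_class_iff dest: le_trans[of A B])
  have mono: "rank A \<le> rank B" if "le A B" for A B
  proof -
    have "below A \<subseteq> below B" unfolding below_def by (auto dest: le_trans[OF that])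
    then show ?thesis unfolding rank_def using fin_below card_mono by blast
  qed
  have strict: "rank B < rank A" if "\<not> le A B" for A B
  proof -
    have BA: "le B A" using that le_total by blast
    then have "below B \<subseteq> below A" unfolding below_def by (auto dest: le_trans[OF BA])
    moreover have "eq_class B \<in> below A" "eq_class B \<notin> below B"
      using that le_refl by (simp_all add: below_iff)
    ultimately show ?thesis unfolding rank_def using fin_below psubset_card_mono by blast
  qed
  \<comment> \<open>Neither the class of \<open>A\<close> nor the top class is below
    \<open>A\<close>, which leaves at most \<open>?m - 2\<close> classes.\<close>
  have rank: "rank A + 2 \<le> ?m" if "A \<notin> T" for A
  proof -
    obtain U where U: "U \<in> T" using derivable_in[OF lc_derivable(1)] by blast
    then have U': "\<not> le U A" "le A U" using that top_le le_top by auto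
    have "eq_class A \<notin> below A" "eq_class U \<notin> below A" "eq_class A \<noteq> eq_class U"
      using U' le_refl by (simp_all add: below_iff eq_class_iff)
    then have "card (insert (eq_class A) (insert (eq_class U) (below A))) = rank A + 2"
      using fin_below[of A] by (simp add: rank_def)
    moreover have "insert (eq_class A) (insert (eq_class U) (below A)) \<subseteq> range eq_class"
      unfolding below_def by auto
    ultimately show ?thesis using card_mono[OF fin(1)] fin(2) by (metis order_trans)
  qed
  \<comment> \<open>The second largest element of \<open>V\<close>, positions being counted from
    0.\<close>
  define c where "c = L ! (?m - 2)"
  have c1: "c < 1"
    using Lmono[of "?m - 2" "?m - 1"] LV[of "?m - 1"] m2 V(1) unfolding c_def by fastforce
  define v where "v A = (if A \<in> T then 1 else L ! rank A)" for A
  have vc: "v A \<le> c" if "A \<notin> T" for A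
    using rank[OF that] Lmono[of "?m - 2" "rank A"] that by (auto simp: v_def c_def not_less[symmetric])
  have "v A \<le> v B \<longleftrightarrow> le A B" for A B
  proof -
    consider "B \<in> T" | "A \<in> T" "B \<notin> T" | "A \<notin> T" "B \<notin> T" by blast
    then show ?thesis
    proof cases
      case 1
      then show ?thesis using le_top vc[of A] c1 by (cases "A \<in> T") (auto simp: v_def)
    next
      case 2
      then show ?thesis using top_le vc[of B] c1 by (auto simp: v_def)
    next
      case 3
      then have "v A \<le> v B \<longleftrightarrow> rank A \<le> rank B"
        using Lmono[of "rank B" "rank A"] rank[of A] rank[of B] by (auto simp: v_def not_less[symmetric])
      then show ?thesis using mono[of A B] strict[of A B] by (cases "le A B") auto
    qed
  qed
  moreover have "v Bot = 0"
    using consistent le_bot L0 by (simp add: v_def rank_def below_def)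
  moreover have "v A \<in> V" "v A = 1 \<longleftrightarrow> A \<in> T" for A
    using V(4) rank[of A] LV[of "rank A"] vc[of A] c1 by (auto simp: v_def)
  ultimately show ?thesis using c1 vc by blast
qed

end

section \<open>Term models\<close>

text \<open>Its set provides the reserved variables; its length, unchanged by substitution, is the
  measure for the induction that bounds truth values.\<close>

primrec binders :: "fm \<Rightarrow> nat list" where
  "binders Bot = []"
| "binders (Pr p ts) = []"
| "binders (Conj A B) = binders A @ binders B"
| "binders (Dis A B) = binders A @ binders B"
| "binders (Imp A B) = binders A @ binders B"
| "binders (All x A) = x # binders A"
| "binders (Ex x A) = x # binders A"

lemma binders_subst: "binders (subst x t A) = binders A"
  by (induction A) auto

lemma quantifier_free_binders: "quantifier_free A \<Longrightarrow> binders A = []"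
  by (induction A) auto

lemma quantifier_free_subst: "quantifier_free (subst x t A) \<longleftrightarrow> quantifier_free A"
  by (induction A) auto

lemma prenex_subst: "prenex A \<Longrightarrow> prenex (subst x t A)"
  by (induction rule: prenex.induct) (auto intro: prenex.intros simp: quantifier_free_subst)

lemma prenex_AllD: "prenex (All x A) \<Longrightarrow> prenex A"
  by (cases rule: prenex.cases) auto

lemma prenex_ExD: "prenex (Ex x A) \<Longrightarrow> prenex A"
  by (cases rule: prenex.cases) auto

text \<open>Every quantifier of the prefix binds in the whole matrix, so no variable is both free
  and bound.\<close>

lemma prenex_free_not_bound: "prenex A \<Longrightarrow> free_vars A \<inter> set (binders A) = {}"
  by (induction rule: prenex.induct) (auto simp: quantifier_free_binders)

lemma free_for_binders: "vars_tm t \<inter> set (binders A) = {} \<Longrightarrow> free_for t x A"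
  by (induction A) auto

lemma vars_subst_tm: "vars_tm (subst_tm x t s) \<subseteq> vars_tm s - {x} \<union> vars_tm t"
  by (induction s) auto

lemma free_vars_subst: "free_vars (subst x t A) \<subseteq> free_vars A - {x} \<union> vars_tm t"
proof (induction A)
  case (Pr p ts)
  then show ?case using vars_subst_tm[of x t] by fastforce
qed (auto split: if_splits)

lemma finite_vars_tm: "finite (vars_tm t)"
  by (induction t) auto

lemma finite_free_vars: "finite (free_vars A)"
  by (induction A) (auto simp: finite_vars_tm)

lemma free_vars_disjunction: "free_vars (disjunction As) = (\<Union>A\<in>set As. free_vars A)"
  by (induction As) auto

section \<open>Absorption of instances and saturation\<close>

lemma derivable_disjunction_mono:
  "derivable X (disjunction As) \<Longrightarrow> set As \<subseteq> set Bs \<Longrightarrow> derivable X (disjunction Bs)"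
  using entails_disjunction_mono[of X "{}" As Bs] by (simp add: entails_empty)

text \<open>The quantifier is introduced over the whole disjunction, where only \<open>A\<close>
  depends on \<open>x\<close>, and then shifted inwards; the repeated disjunct \<open>Ex x A\<close>
  is contracted.\<close>

lemma derivable_absorb_Ex:
  assumes "derivable X (disjunction (subst x t A # As))" and "Ex x A \<in> set As"
    and "free_for t x A" and "x \<notin> free_vars (disjunction As)"
  shows "derivable X (disjunction As)"
proof -
  let ?G = "disjunction As"
  have "derivable X (subst x t (Dis A ?G))" using assms(1) by (simp add: subst_fresh[OF assms(4)])
  then have "derivable X (Ex x (Dis A ?G))"
    by (rule derivable.ex_intro) (simp add: assms(3) free_for_fresh[OF assms(4)])
  then have "derivable X (disjunction (Ex x A # As))"
    using derivable.ex_shift[OF _ assms(4)] by simp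
  then show ?thesis by (rule derivable_disjunction_mono) (use assms(2) in auto)
qed

text \<open>As in the existential case, with \<open>y\<close> as eigenvariable; it must be fresh for
  the side disjuncts too, since they lie in the scope of the generalization.\<close>

lemma derivable_absorb_All:
  assumes "derivable X (disjunction (subst x (Var y) A # As))" and "All x A \<in> set As"
    and "free_for (Var y) x A" and "x \<notin> free_vars (disjunction As)"
    and "y \<notin> free_vars (disjunction As)"
  shows "derivable X (disjunction As)"
proof -
  let ?G = "disjunction As"
  have "y \<notin> free_vars (All x A)" using assms(2,5) by (auto simp: free_vars_disjunction)
  then have y: "y \<notin> free_vars (All x (Dis A ?G))" using assms(5) by auto
  have "derivable X (subst x (Var y) (Dis A ?G))"
    using assms(1) by (simp add: subst_fresh[OF assms(4)])
  then have "derivable X (All x (Dis A ?G))"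
    by (rule derivable.all_intro[OF _ _ y]) (simp add: assms(3) free_for_fresh[OF assms(4)])
  then have "derivable X (disjunction (All x A # As))"
    using derivable.all_shift[OF _ assms(4)] by simp
  then show ?thesis by (rule derivable_disjunction_mono) (use assms(2) in auto)
qed

text \<open>The first component of the code is padding, which makes each pair recur beyond every
  bound.\<close>

lemma recurrent_enumeration:
  obtains task :: "nat \<Rightarrow> fm \<times> tm" where "\<And>B t N. \<exists>n\<ge>N. task n = (B, t)"
proof -
  define task where "task n = (let m = prod_decode (snd (prod_decode n)) in
    (inv code_fm (fst m), inv code_tm (snd m)))" for n
  have "inj code_fm" "inj code_tm" by (auto intro: injI code_fm_inject code_tm_inject)
  then have "task (prod_encode (N, prod_encode (code_fm B, code_tm t))) = (B, t)" for B t N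
    by (simp add: task_def)
  then show ?thesis using that le_prod_encode_1 by blast
qed

text \<open>Separates the variables: bound ones in \<open>W\<close>, free ones outside. Substituting
  a term that avoids \<open>W\<close> then causes no capture and preserves the separation.\<close>

definition regular :: "nat set \<Rightarrow> fm \<Rightarrow> bool" where
  "regular W B \<longleftrightarrow> prenex B \<and> set (binders B) \<subseteq> W \<and> free_vars B \<inter> W = {}"

lemma regular_AllD:
  assumes "regular W (All x C)" "vars_tm t \<inter> W = {}"
  shows "x \<in> W" "free_for t x C" "regular W (subst x t C)"
  using assms prenex_AllD[of x C] prenex_subst[of C x t] free_vars_subst[of x t C]
  by (auto simp: regular_def binders_subst intro!: free_for_binders)

lemma regular_ExD:
  assumes "regular W (Ex x C)" "vars_tm t \<inter> W = {}"
  shows "x \<in> W" "free_for t x C" "regular W (subst x t C)"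
  using assms prenex_ExD[of x C] prenex_subst[of C x t] free_vars_subst[of x t C]
  by (auto simp: regular_def binders_subst intro!: free_for_binders)

lemma regular_disjunction:
  "\<forall>B\<in>set As. regular W B \<Longrightarrow> x \<in> W \<Longrightarrow> x \<notin> free_vars (disjunction As)"
  by (auto simp: free_vars_disjunction regular_def)

text \<open>A Henkin construction on the refuted side: finite underivable disjunctions grow by one
  instance per task, and the absorption lemmas keep them underivable.\<close>

lemma saturated_extension:
  assumes A: "prenex A" "\<not> derivable X A"
  defines "W \<equiv> set (binders A)"
  obtains D where "A \<in> D" "\<And>As. set As \<subseteq> D \<Longrightarrow> \<not> derivable X (disjunction As)"
    "\<And>B. B \<in> D \<Longrightarrow> regular W B"
    "\<And>x C. All x C \<in> D \<Longrightarrow> \<exists>y. y \<notin> W \<and> subst x (Var y) C \<in> D"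
    "\<And>x C t. Ex x C \<in> D \<Longrightarrow> vars_tm t \<inter> W = {} \<Longrightarrow> subst x t C \<in> D"
proof -
  define good where "good G \<longleftrightarrow> \<not> derivable X (disjunction G) \<and> (\<forall>B\<in>set G. regular W B)" for G
  have "\<exists>G'. good G' \<and> set G \<subseteq> set G' \<and>
      (\<forall>x C. B = All x C \<longrightarrow> B \<in> set G \<longrightarrow> (\<exists>y. y \<notin> W \<and> subst x (Var y) C \<in> set G')) \<and>
      (\<forall>x C. B = Ex x C \<longrightarrow> B \<in> set G \<longrightarrow> vars_tm t \<inter> W = {} \<longrightarrow> subst x t C \<in> set G')"
    (is "\<exists>G'. ?next G B t G'") if G: "good G" for G B t
  proof -
    consider (All) x C where "B = All x C" "B \<in> set G"
      | (Ex) x C where "B = Ex x C" "B \<in> set G" "vars_tm t \<inter> W = {}"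
      | (other) "\<nexists>x C. B = All x C \<and> B \<in> set G" "\<nexists>x C. B = Ex x C \<and> B \<in> set G \<and> vars_tm t \<inter> W = {}"
      by blast
    then show ?thesis
    proof cases
      case All
      \<comment> \<open>Each stage is finite, so a variable fresh for it and for \<open>W\<close>
        remains available.\<close>
      have "finite (W \<union> free_vars (disjunction G))" by (simp add: W_def finite_free_vars)
      then obtain y where y: "y \<notin> W" "y \<notin> free_vars (disjunction G)"
        using ex_new_if_finite[OF infinite_UNIV_nat] by blast
      have "regular W (All x C)" using G All by (auto simp: good_def)
      note r = regular_AllD[OF this, of "Var y"]
      have "good (subst x (Var y) C # G)"
        using G All r y regular_disjunction[of G W x] derivable_absorb_All[of X x y C G]
        by (auto simp: good_def)
      then show ?thesis using All y(1) by (intro exI[of _ "subst x (Var y) C # G"]) auto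
    next
      case Ex
      have "regular W (Ex x C)" using G Ex by (auto simp: good_def)
      note r = regular_ExD[OF this Ex(3)]
      have "good (subst x t C # G)"
        using G Ex r regular_disjunction[of G W x] derivable_absorb_Ex[of X x t C G]
        by (auto simp: good_def)
      then show ?thesis using Ex by (intro exI[of _ "subst x t C # G"]) auto
    next
      case other
      then show ?thesis using G by (intro exI[of _ G]) auto
    qed
  qed
  then obtain nxt where nxt: "\<And>G B t. good G \<Longrightarrow> ?next G B t (nxt G B t)" by metis
  obtain task :: "nat \<Rightarrow> fm \<times> tm" where task: "\<And>B t N. \<exists>n\<ge>N. task n = (B, t)"
    using recurrent_enumeration by blast
  define G where "G = rec_nat [A] (\<lambda>n G. nxt G (fst (task n)) (snd (task n)))"
  have G_simps: "G 0 = [A]" "G (Suc n) = nxt (G n) (fst (task n)) (snd (task n))" for n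
    by (simp_all add: G_def)
  have good: "good (G n)" for n
  proof (induction n)
    case 0
    have "regular W A" using A(1) prenex_free_not_bound[OF A(1)] by (simp add: regular_def W_def)
    moreover have "\<not> derivable X (Dis A Bot)"
    proof
      assume "derivable X (Dis A Bot)"
      then have "entails X {} (Dis A Bot)" by (simp add: entails_empty)
      then have "entails X {} A"
        by (rule entails_disE) (auto intro: entails.hyp entails_botE)
      then show False using A(2) by (simp add: entails_empty)
    qed
    ultimately show ?case by (simp add: G_simps good_def)
  next
    case (Suc n)
    then show ?case using nxt by (simp add: G_simps)
  qed
  have mono: "m \<le> n \<Longrightarrow> set (G m) \<subseteq> set (G n)" for m n
  proof (induction rule: dec_induct)
    case (step n)
    then show ?case using nxt[OF good[of n]] unfolding G_simps by blast
  qed simp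
  define D where "D = (\<Union>n. set (G n))"
  have in_later: "\<exists>n. task n = (B, t) \<and> B \<in> set (G n)" if B: "B \<in> D" for B t
  proof -
    obtain m where m: "B \<in> set (G m)" using B by (auto simp: D_def)
    obtain n where "n \<ge> m" "task n = (B, t)" using task by blast
    then show ?thesis using m mono by blast
  qed
  show ?thesis
  proof
    show "A \<in> D" using G_simps(1) by (auto simp: D_def intro!: exI[of _ 0])
    show "\<not> derivable X (disjunction As)" if As: "set As \<subseteq> D" for As
    proof -
      \<comment> \<open>A finite list from the increasing union lies in a single stage.\<close>
      have "\<exists>n. set As \<subseteq> set (G n)"
        using As
      proof (induction As)
        case (Cons B As)
        then obtain m n where "set As \<subseteq> set (G m)" "B \<in> set (G n)" by (auto simp: D_def)
        then have "set (B # As) \<subseteq> set (G (max m n))"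
          using mono[of m "max m n"] mono[of n "max m n"] by auto
        then show ?case by blast
      qed simp
      then show ?thesis using good derivable_disjunction_mono unfolding good_def by blast
    qed
    show "regular W B" if "B \<in> D" for B using that good by (auto simp: D_def good_def)
    show "\<exists>y. y \<notin> W \<and> subst x (Var y) C \<in> D" if "All x C \<in> D" for x C
    proof -
      note all = that
      \<comment> \<open>\<open>Var 0\<close> is a filler; a universal task chooses its own fresh
        variable.\<close>
      obtain n where n: "task n = (All x C, Var 0)" "All x C \<in> set (G n)" using in_later[OF all] by blast
      then obtain y where "y \<notin> W" "subst x (Var y) C \<in> set (G (Suc n))"
        using nxt[OF good[of n], of "All x C" "Var 0"] by (auto simp: G_simps)
      then show ?thesis unfolding D_def by blast
    qed
    show "subst x t C \<in> D" if "Ex x C \<in> D" "vars_tm t \<inter> W = {}" for x C t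
    proof -
      note ex = that
      obtain n where n: "task n = (Ex x C, t)" "Ex x C \<in> set (G n)" using in_later[OF ex(1)] by blast
      then have "subst x t C \<in> set (G (Suc n))"
        using nxt[OF good[of n], of "Ex x C" t] ex(2) by (auto simp: G_simps)
      then show ?thesis unfolding D_def by blast
    qed
  qed
qed

text \<open>
  The domain of the term model consists of the terms without variables from \<open>W\<close> (the variables
  bound in the formula to be refuted), embedded into the given infinite type by \<open>e\<close>.
\<close>

definition term_model :: "nat set \<Rightarrow> (tm \<Rightarrow> 'd) \<Rightarrow> (fm \<Rightarrow> real) \<Rightarrow> 'd interp" where
  "term_model W e v = \<lparr>
     Dom = e ` {t. vars_tm t \<inter> W = {}},
     VarI = \<lambda>x. e (Var (if x \<in> W then SOME z. z \<notin> W else x)),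
     FnI = \<lambda>f ds. e (Fn f (map (inv e) ds)),
     PrI = \<lambda>p ds. v (Pr p (map (inv e) ds))\<rparr>"

section \<open>Evaluation in the term model\<close>

lemma term_model_simps:
  "Dom (term_model W e v) = e ` {t. vars_tm t \<inter> W = {}}"
  "VarI (term_model W e v) x = e (Var (if x \<in> W then SOME z. z \<notin> W else x))"
  "FnI (term_model W e v) f ds = e (Fn f (map (inv e) ds))"
  "PrI (term_model W e v) p ds = v (Pr p (map (inv e) ds))"
  by (simp_all add: term_model_def)

lemma interp_on_term_model:
  assumes "inj e" "finite W" "\<And>A. v A \<in> V"
  shows "interp_on V (term_model W e v)"
proof -
  \<comment> \<open>Variables in \<open>W\<close> are not domain elements, so the model assigns them
    a fixed variable outside the finite set \<open>W\<close>.\<close>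
  have z: "(SOME z. z \<notin> W) \<notin> W"
    using ex_new_if_finite[OF infinite_UNIV_nat assms(2)] by (rule someI_ex)
  have x: "Var (if x \<in> W then SOME z. z \<notin> W else x) \<in> {t. vars_tm t \<inter> W = {}}" for x
    using z by simp
  have Fn: "Fn f (map (inv e) ds) \<in> {t. vars_tm t \<inter> W = {}}"
    if ds: "ds \<in> lists (e ` {t. vars_tm t \<inter> W = {}})" for f ds
  proof -
    have "vars_tm (inv e d) \<inter> W = {}" if "d \<in> set ds" for d
    proof -
      obtain t where "d = e t" "vars_tm t \<inter> W = {}"
        using ds \<open>d \<in> set ds\<close> by (auto simp: in_lists_conv_set)
      then show ?thesis using assms(1) by simp
    qed
    then show ?thesis by auto
  qed
  have "Dom (term_model W e v) \<noteq> {}" unfolding term_model_simps(1) using x by blast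
  then show ?thesis
    unfolding interp_on_def term_model_simps using x Fn assms(3) by blast
qed

lemma eval_tm_term_model:
  assumes "inj e"
  shows "vars_tm t \<inter> W = {} \<Longrightarrow> eval_tm (term_model W e v) t = e t"
proof (induction t)
  case (Var x)
  then show ?case by (simp add: term_model_simps)
next
  case (Fn f ts)
  have "eval_tm (term_model W e v) s = e s" if "s \<in> set ts" for s
    using Fn.prems that by (intro Fn.IH[OF that]) auto
  then have "map (inv e) (map (eval_tm (term_model W e v)) ts) = ts"
    using assms by (intro map_idI[of _ "inv e \<circ> _", unfolded map_map[symmetric]]) simp
  then show ?case by (simp only: eval_tm.simps term_model_simps)
qed

lemma eval_term_model_quantifier_free:
  assumes "inj e" and v: "v Bot = 0" "\<And>A B. v (Conj A B) = min (v A) (v B)"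
    "\<And>A B. v (Dis A B) = max (v A) (v B)" "\<And>A B. v (Imp A B) = (if v A > v B then v B else 1)"
  shows "quantifier_free B \<Longrightarrow> free_vars B \<inter> W = {} \<Longrightarrow> eval B (term_model W e v) = v B"
proof (induction B)
  case (Pr p ts)
  have "eval_tm (term_model W e v) s = e s" if "s \<in> set ts" for s
    using Pr.prems(2) that by (intro eval_tm_term_model[OF assms(1)]) auto
  then have "map (inv e) (map (eval_tm (term_model W e v)) ts) = ts"
    using assms(1) by (intro map_idI[of _ "inv e \<circ> _", unfolded map_map[symmetric]]) simp
  then show ?case by (simp only: eval.simps term_model_simps)
qed (use v in \<open>auto simp: Int_Un_distrib2\<close>)

section \<open>Completeness for prenex formulas\<close>

theorem prenex_complete:
  assumes V: "truth_value_set V" "finite V \<or> uncountable V" and inf: "infinite (UNIV :: 'd set)"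
    and A: "prenex A" "A \<in> goedel_logic TYPE('d) V"
  shows "derivable (extra_axioms V) A"
proof (rule ccontr)
  let ?X = "extra_axioms V" and ?W = "set (binders A)"
  assume "\<not> derivable ?X A"
  from saturated_extension[OF A(1) this] obtain D where D: "A \<in> D"
    and underivable: "\<And>As. set As \<subseteq> D \<Longrightarrow> \<not> derivable ?X (disjunction As)"
    and regular: "\<And>B. B \<in> D \<Longrightarrow> regular ?W B"
    and All: "\<And>x C. All x C \<in> D \<Longrightarrow> \<exists>y. y \<notin> ?W \<and> subst x (Var y) C \<in> D"
    and Ex: "\<And>x C t. Ex x C \<in> D \<Longrightarrow> vars_tm t \<inter> ?W = {} \<Longrightarrow> subst x t C \<in> D"
    by blast
  obtain T where "prime_theory ?X T" and DT: "D \<inter> T = {}"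
    using prime_theory_avoiding[OF underivable] by blast
  then interpret prime_theory ?X T by simp
  have V': "V \<subseteq> {0..1}" "0 \<in> V" "1 \<in> V" using V(1) by (simp_all add: truth_value_set_def)
  have "\<exists>v c. (\<forall>A. v A \<in> V) \<and> (\<forall>A B. v A \<le> v B \<longleftrightarrow> le A B) \<and> v Bot = 0 \<and>
    (\<forall>A. v A = 1 \<longleftrightarrow> A \<in> T) \<and> c < 1 \<and> (\<forall>A. A \<notin> T \<longrightarrow> v A \<le> c)"
  proof (cases "finite V")
    case True
    have "finite_axiom (card V) B \<in> T" for B
      using True by (intro derivable_in derivable.extra) (simp add: extra_axioms_def)
    then show ?thesis using finite_valuation[OF V'(1) True V'(2,3)] by blast
  next
    case False
    then show ?thesis using V(2) uncountable_valuation[OF V'(1) _ V'(2,3)] by blast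
  qed
  then obtain v c where v: "\<And>A. v A \<in> V" "\<And>A B. v A \<le> v B \<longleftrightarrow> le A B" "v Bot = 0"
    "\<And>A. v A = 1 \<longleftrightarrow> A \<in> T" and c: "c < 1" "\<And>A. A \<notin> T \<Longrightarrow> v A \<le> c"
    by blast
  \<comment> \<open>Terms have numerical codes and therefore embed into any infinite type.\<close>
  obtain g :: "nat \<Rightarrow> 'd" where "inj g" using infinite_countable_subset[OF inf] by blast
  then have e: "inj (g \<circ> code_tm)" by (auto intro!: inj_compose injI code_tm_inject dest: injD)
  let ?e = "g \<circ> code_tm"
  let ?I = "term_model ?W ?e v"
  have I: "interp_on V ?I" by (rule interp_on_term_model[OF e _ v(1)]) simp
  \<comment> \<open>Instances are not subformulas, but they have one quantifier fewer.\<close>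
  have "eval B ?I \<le> c" if "B \<in> D" for B
    using that
  proof (induction "length (binders B)" arbitrary: B rule: less_induct)
    case less
    have r: "regular ?W B" using regular less.prems by blast
    then have "prenex B" by (simp add: regular_def)
    then show ?case
    proof cases
      case 1
      have "eval B ?I = v B"
        using eval_term_model_quantifier_free[OF e v(3) valuation_connectives[OF v(2,4)] 1] r
        by (simp add: regular_def)
      then show ?thesis using c(2) DT less.prems by auto
    next
      case (2 C x)
      then obtain y where y: "y \<notin> ?W" "subst x (Var y) C \<in> D" using All less.prems by blast
      have yW: "vars_tm (Var y) \<inter> ?W = {}" using y(1) by simp
      have ff: "free_for (Var y) x C" using regular_AllD(2)[OF _ yW] r 2 by blast
      let ?f = "\<lambda>d. eval C (?I\<lparr>VarI := (VarI ?I)(x := d)\<rparr>)"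
      \<comment> \<open>The infimum lies below the value at the one instance known to belong to
        \<open>D\<close>.\<close>
      have "bdd_below (?f ` Dom ?I)"
        using eval_bounds(1)[OF V(1) interp_on_update[OF I]] by (intro bdd_belowI[of _ 0]) auto
      then have "Inf (?f ` Dom ?I) \<le> ?f (eval_tm ?I (Var y))"
        by (rule cINF_lower[OF _ eval_tm_in_Dom[OF I]])
      then have "eval B ?I \<le> ?f (eval_tm ?I (Var y))" by (simp only: 2(1) eval.simps)
      also have "\<dots> = eval (subst x (Var y) C) ?I" by (rule eval_subst[OF ff, symmetric])
      also have "\<dots> \<le> c" by (rule less.hyps) (use y(2) 2 binders_subst in auto)
      finally show ?thesis .
    next
      case (3 C x)
      have "eval C (?I\<lparr>VarI := (VarI ?I)(x := d)\<rparr>) \<le> c" if d: "d \<in> Dom ?I" for d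
      proof -
        \<comment> \<open>Every domain element is named by a term avoiding \<open>W\<close>, and all
          instances with such terms belong to \<open>D\<close>; so \<open>c\<close> bounds the
          supremum.\<close>
        obtain t where t: "vars_tm t \<inter> ?W = {}" "d = ?e t" using d by (auto simp: term_model_def)
        have ff: "free_for t x C" using regular_ExD(2)[OF _ t(1)] r 3 by blast
        have "d = eval_tm ?I t" using eval_tm_term_model[OF e t(1)] t(2) by simp
        then have "eval C (?I\<lparr>VarI := (VarI ?I)(x := d)\<rparr>) = eval (subst x t C) ?I"
          by (simp only: eval_subst[OF ff])
        also have "\<dots> \<le> c"
          by (rule less.hyps) (use Ex[OF _ t(1)] less.prems 3 binders_subst in auto)
        finally show ?thesis .
      qed
      moreover have "Dom ?I \<noteq> {}" using I by (simp add: interp_on_def)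
      ultimately show ?thesis using 3(1) by (auto intro: cSUP_least)
    qed
  qed
  then have "eval A ?I \<le> c" using D by blast
  moreover have "eval A ?I = 1" using A(2) I by (simp add: goedel_logic_def)
  ultimately show False using c(1) by simp
qed

theorem theorem5p9:
  fixes V :: "real set"
  assumes "truth_value_set V"
    and "finite V \<or> uncountable V"
    and "infinite (UNIV :: 'd set)"
  shows "axiomatizable (prenex_fragment TYPE('d) V) \<and>
    (\<forall>A. prenex A \<longrightarrow> (A \<in> goedel_logic TYPE('d) V \<longleftrightarrow> derivable (extra_axioms V) A))"
proof -
  have iff: "A \<in> goedel_logic TYPE('d) V \<longleftrightarrow> derivable (extra_axioms V) A" if "prenex A" for A
    using prenex_complete[OF assms that] derivable_sound[OF assms(1), of A]
    by (auto simp: goedel_logic_def)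
  have "prenex_fragment TYPE('d) V =
    {A. prenex A \<and> derivable (calculus_axioms (if finite V then Some (card V) else None)) A}"
    using iff by (auto simp: prenex_fragment_def calculus_axioms_def extra_axioms_def)
  then show ?thesis using iff axiomatizable_prenex_derivable by simp
qed

end
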